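(* Let $D$ be a $2$-in-regular digraph, and let $J_1,\dots,J_{15}$ be the fifteen digraphs listed in the context. Then $D$ admits a $(1,\le 3)$-identifying code if and only if $D$ is a $TT_3$-free oriented graph and $D$ does not contain any subdigraph isomorphic to one of $J_1,\dots,J_{15}$.
   Context: Digraphs have no loops and no multiple arcs, but may contain both arcs $(u,v)$ and $(v,u)$ (a digon). An oriented graph is a digraph without digons. $TT_3$ is the transitive tournament on three vertices (arcs $(a,b),(b,c),(a,c)$); $D$ is $TT_3$-free if it contains no subdigraph isomorphic to $TT_3$. For a vertex $u$, $N^-(u)=\{v:(v,u)\in A\}$ and $N^-[u]=N^-(u)\cup\{u\}$; for a vertex set $U$, $N^-[U]=\bigcup_{u\in U}N^-[u]$. A digraph is $2$-in-regular if $|N^-(u)|=2$ for every vertex $u$. A set $C\subseteq V$ is a $(1,\le\ell)$-identifying code in $D$ if $N^-[X]\cap C\ne N^-[Y]\cap C$ for all distinct $X,Y\subseteq V$ with $1\le|X|,|Y|\le\ell$; $D$ admits such a code if some such $C$ exists. Subdigraphs are not necessarily induced. Differently named vertices in each $J_i$ are distinct. Writing $a\to b$ for the arc $(a,b)$, and $a,b\to c$ for the two arcs $(a,c),(b,c)$, the arc sets are: $J_1$: $p,q\to a$; $p,q\to b$; $a\to c$. $J_2$: $p,q\to a$; $a,r\to b$; $b\to p$; $q\to r$. $J_3$: $p,q\to a$; $a,r\to b$; $b\to p$; $r\to q$. $J_4$: $s,p\to a$; $s,q\to b$; $a\to q$; $b\to p$. $J_5$: $s,p\to a$; $s,q\to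 b$; $a\to q$; $b,p\to d$. $J_6$: $s,p\to a$; $s,q\to b$; $a,b\to c$; $p\to q$. $J_7$: $p,q\to a$; $a,r\to b$; $b,p\to c$; $r\to q$. $J_8$: $p,q\to a$; $a,r\to b$; $b,p\to c$; $q\to r$. $J_9$: $p,q\to a$; $a,r\to b$; $b\to p$; $q,r\to d$. $J_{10}$: $p,q\to a$; $a,r\to b$; $b,p\to c$; $q,r\to d$. $J_{11}$: $s,p\to a$; $s,q\to b$; $a,b\to c$; $p,q\to d$. $J_{12}$: $s,p\to a$; $s,q\to b$; $a,q\to c$; $b,p\to d$. $J_{13}$ (9 vertices): the directed cycle $c_1\to c_2\to c_3\to c_4\to c_5\to c_6\to c_1$ together with $v_1\to c_1$, $v_1\to c_4$, $v_2\to c_2$, $v_2\to c_5$, $v_3\to c_3$, $v_3\to c_6$. $J_{14}$ (9 vertices): the directed cycle $c_1\to c_2\to c_3\to c_4\to c_1$, the arcs $e_i\to c_i$ for $i=1,2,3,4$, and $e_3,f\to e_1$; $e_2,e_4\to f$. $J_{15}$ (9 vertices): the directed cycle $c_1\to c_2\to c_3\to c_4\to c_1$, the arcs $e_i\to c_i$ for $i=1,2,3,4$, and $e_3,f\to e_1$; $e_4,f\to e_2$. *)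

theory Defs
  imports Graph_Theory.Graph_Theory
begin

text \<open>
  Digraphs without loops and without multiple arcs are the \<^typ>\<open>('a, 'b) pre_digraph\<close>s
  satisfying both \<^locale>\<open>loopfree_digraph\<close> and \<^locale>\<open>nomulti_digraph\<close>. The locale
  \<^locale>\<open>digraph\<close> would in addition require finiteness, which is not assumed here.
\<close>

definition in_nbrs :: "('a, 'b) pre_digraph \<Rightarrow> 'a \<Rightarrow> 'a set" where
  "in_nbrs D u = {v. v \<rightarrow>\<^bsub>D\<^esub> u}"

definition closed_in_nbrs :: "('a, 'b) pre_digraph \<Rightarrow> 'a \<Rightarrow> 'a set" where
  "closed_in_nbrs D u = in_nbrs D u \<union> {u}"

definition closed_in_nbrs_set :: "('a, 'b) pre_digraph \<Rightarrow> 'a set \<Rightarrow> 'a set" where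
  "closed_in_nbrs_set D U = (\<Union>u\<in>U. closed_in_nbrs D u)"

definition in_regular :: "nat \<Rightarrow> ('a, 'b) pre_digraph \<Rightarrow> bool" where
  "in_regular k D \<longleftrightarrow> (\<forall>u\<in>verts D. finite (in_nbrs D u) \<and> card (in_nbrs D u) = k)"

text \<open>
  \<open>identifying_code D l C\<close>: \<open>C\<close> is a \<open>(1, \<le> l)\<close>-identifying code in \<open>D\<close>. Since infinite sets
  have \<^const>\<open>card\<close> zero, the lower bounds make \<open>X\<close> and \<open>Y\<close> finite and nonempty.
\<close>
definition identifying_code :: "('a, 'b) pre_digraph \<Rightarrow> nat \<Rightarrow> 'a set \<Rightarrow> bool" where
  "identifying_code D l C \<longleftrightarrow> C \<subseteq> verts D \<and>
     (\<forall>X Y. X \<subseteq> verts D \<and> Y \<subseteq> verts D \<and> X \<noteq> Y \<and>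
        1 \<le> card X \<and> card X \<le> l \<and> 1 \<le> card Y \<and> card Y \<le> l \<longrightarrow>
        closed_in_nbrs_set D X \<inter> C \<noteq> closed_in_nbrs_set D Y \<inter> C)"

definition admits_identifying_code :: "('a, 'b) pre_digraph \<Rightarrow> nat \<Rightarrow> bool" where
  "admits_identifying_code D l \<longleftrightarrow> (\<exists>C. identifying_code D l C)"

definition oriented_graph :: "('a, 'b) pre_digraph \<Rightarrow> bool" where
  "oriented_graph D \<longleftrightarrow> loopfree_digraph D \<and> nomulti_digraph D \<and>
     \<not> (\<exists>u v. u \<rightarrow>\<^bsub>D\<^esub> v \<and> v \<rightarrow>\<^bsub>D\<^esub> u)"

definition contains_copy :: "('a, 'b) pre_digraph \<Rightarrow> ('c, 'd) pre_digraph \<Rightarrow> bool" where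
  "contains_copy D J \<longleftrightarrow> (\<exists>H. subgraph H D \<and> digraph_iso H J)"

text \<open>
  The concrete digraphs have strings as vertex names and pairs of vertices as arcs; none of them
  has an isolated vertex, so the arcs determine the vertices.
\<close>
definition digraph_of_arcs :: "'a rel \<Rightarrow> ('a, 'a \<times> 'a) pre_digraph" where
  "digraph_of_arcs A = with_proj \<lparr> pverts = fst ` A \<union> snd ` A, parcs = A \<rparr>"

definition TT3 :: "(string, string \<times> string) pre_digraph" where
  "TT3 = digraph_of_arcs {(''a'',''b''), (''b'',''c''), (''a'',''c'')}"

definition J1 :: "(string, string \<times> string) pre_digraph" where
  "J1 = digraph_of_arcs {(''p'',''a''), (''q'',''a''), (''p'',''b''), (''q'',''b''), (''a'',''c'')}"

definition J2 :: "(string, string \<times> string) pre_digraph" where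
  "J2 = digraph_of_arcs
    {(''p'',''a''), (''q'',''a''), (''a'',''b''), (''r'',''b''), (''b'',''p''), (''q'',''r'')}"

definition J3 :: "(string, string \<times> string) pre_digraph" where
  "J3 = digraph_of_arcs
    {(''p'',''a''), (''q'',''a''), (''a'',''b''), (''r'',''b''), (''b'',''p''), (''r'',''q'')}"

definition J4 :: "(string, string \<times> string) pre_digraph" where
  "J4 = digraph_of_arcs
    {(''s'',''a''), (''p'',''a''), (''s'',''b''), (''q'',''b''), (''a'',''q''), (''b'',''p'')}"

definition J5 :: "(string, string \<times> string) pre_digraph" where
  "J5 = digraph_of_arcs
    {(''s'',''a''), (''p'',''a''), (''s'',''b''), (''q'',''b''), (''a'',''q''), (''b'',''d''), (''p'',''d'')}"

definition J6 :: "(string, string \<times> string) pre_digraph" where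
  "J6 = digraph_of_arcs
    {(''s'',''a''), (''p'',''a''), (''s'',''b''), (''q'',''b''), (''a'',''c''), (''b'',''c''), (''p'',''q'')}"

definition J7 :: "(string, string \<times> string) pre_digraph" where
  "J7 = digraph_of_arcs
    {(''p'',''a''), (''q'',''a''), (''a'',''b''), (''r'',''b''), (''b'',''c''), (''p'',''c''), (''r'',''q'')}"

definition J8 :: "(string, string \<times> string) pre_digraph" where
  "J8 = digraph_of_arcs
    {(''p'',''a''), (''q'',''a''), (''a'',''b''), (''r'',''b''), (''b'',''c''), (''p'',''c''), (''q'',''r'')}"

definition J9 :: "(string, string \<times> string) pre_digraph" where
  "J9 = digraph_of_arcs
    {(''p'',''a''), (''q'',''a''), (''a'',''b''), (''r'',''b''), (''b'',''p''), (''q'',''d''), (''r'',''d'')}"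

definition J10 :: "(string, string \<times> string) pre_digraph" where
  "J10 = digraph_of_arcs
    {(''p'',''a''), (''q'',''a''), (''a'',''b''), (''r'',''b''), (''b'',''c''), (''p'',''c''), (''q'',''d''), (''r'',''d'')}"

definition J11 :: "(string, string \<times> string) pre_digraph" where
  "J11 = digraph_of_arcs
    {(''s'',''a''), (''p'',''a''), (''s'',''b''), (''q'',''b''), (''a'',''c''), (''b'',''c''), (''p'',''d''), (''q'',''d'')}"

definition J12 :: "(string, string \<times> string) pre_digraph" where
  "J12 = digraph_of_arcs
    {(''s'',''a''), (''p'',''a''), (''s'',''b''), (''q'',''b''), (''a'',''c''), (''q'',''c''), (''b'',''d''), (''p'',''d'')}"

definition J13 :: "(string, string \<times> string) pre_digraph" where
  "J13 = digraph_of_arcs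
    {(''c1'',''c2''), (''c2'',''c3''), (''c3'',''c4''), (''c4'',''c5''), (''c5'',''c6''), (''c6'',''c1''),
     (''v1'',''c1''), (''v1'',''c4''), (''v2'',''c2''), (''v2'',''c5''), (''v3'',''c3''), (''v3'',''c6'')}"

definition J14 :: "(string, string \<times> string) pre_digraph" where
  "J14 = digraph_of_arcs
    {(''c1'',''c2''), (''c2'',''c3''), (''c3'',''c4''), (''c4'',''c1''),
     (''e1'',''c1''), (''e2'',''c2''), (''e3'',''c3''), (''e4'',''c4''),
     (''e3'',''e1''), (''f'',''e1''), (''e2'',''f''), (''e4'',''f'')}"

definition J15 :: "(string, string \<times> string) pre_digraph" where
  "J15 = digraph_of_arcs
    {(''c1'',''c2''), (''c2'',''c3''), (''c3'',''c4''), (''c4'',''c1''),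
     (''e1'',''c1''), (''e2'',''c2''), (''e3'',''c3''), (''e4'',''c4''),
     (''e3'',''e1''), (''f'',''e1''), (''e4'',''e2''), (''f'',''e2'')}"

definition forbidden_digraphs :: "(string, string \<times> string) pre_digraph set" where
  "forbidden_digraphs = {J1, J2, J3, J4, J5, J6, J7, J8, J9, J10, J11, J12, J13, J14, J15}"

end

theory Submission
  imports Defs
begin

text \<open>
  Write \<open>N u\<close> for the closed in-neighbourhood of \<open>u\<close>, a set of three vertices. A code stays a code
  when it is enlarged, so the question is whether the set of all vertices is one: whether
  \<open>\<Union>(N ` X) = \<Union>(N ` Y)\<close> forces \<open>X = Y\<close> for sets of one to three vertices
  (\<open>admits_iff_separated\<close>).

  Each forbidden configuration shows two different sets with the same union. With a digon, a
  transitive triangle or \<open>J1\<close>, some \<open>N x\<close> is covered by \<open>N y \<union> N z\<close>, and then \<open>{x, y, z}\<close> and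
  \<open>{y, z}\<close> clash. In \<open>J2\<close> to \<open>J12\<close> the sets \<open>N a\<close> and \<open>N b\<close> share a vertex \<open>s\<close>, and the two other
  vertices of \<open>N a\<close> are matched with those of \<open>N b\<close> such that one pair lies in \<open>N z\<close> and the
  other one in \<open>N w\<close>; then \<open>{a, z, w}\<close> and \<open>{b, z, w}\<close> clash. \<open>J13\<close> to \<open>J15\<close> contain
  two disjoint triples that clash.

  Conversely, suppose that none of these configurations occurs and that \<open>X \<noteq> Y\<close> have the same
  union. Let \<open>x \<in> X - Y\<close>. As \<open>x\<close> is covered by \<open>Y\<close>, it has an out-neighbour, and then
  excluding digons, transitive triangles and \<open>J1\<close> leaves at most one common vertex of \<open>N x\<close> and
  \<open>N y\<close> for every \<open>y \<noteq> x\<close> (\<open>common_nbr_unique\<close>). Hence covering the three vertices of \<open>N x\<close>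
  takes three members of \<open>Y\<close>, and each of them covers exactly one
  (\<open>covered_imp_splits\<close>). By symmetry \<open>X\<close> and \<open>Y\<close> both have three elements, and the number of
  elements of \<open>X - Y\<close> leaves three cases.

  \<^item> One vertex \<open>x\<close> is exchanged for one vertex \<open>y\<close>. Then \<open>N x\<close> and \<open>N y\<close> share one vertex and the
    remaining ones are matched through the two common members of \<open>X\<close> and \<open>Y\<close>. The possible shapes
    of such a matching are \<open>J2\<close> to \<open>J12\<close> (\<open>no_exchange\<close>).
  \<^item> Two vertices are exchanged for two, and one vertex \<open>z\<close> is common. The four exchanged closed
    in-neighbourhoods each contain exactly one of the three vertices of \<open>N z\<close>. So two of
    them contain the same one, and these two must lie on the same side; they are then
    matched through the two vertices of the other side, and the first case applies.
  \<^item> \<open>X\<close> and \<open>Y\<close> are disjoint. The sets \<open>N x\<close> with \<open>x \<in> X\<close> and the sets \<open>N y\<close> with \<open>y \<in> Y\<close> are two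
    partitions of the same nine vertices, like the rows and the columns of a square. Every member of
    \<open>X\<close> has an out-neighbour in \<open>Y\<close> and vice versa, so there is a directed cycle that
    alternates between \<open>X\<close> and \<open>Y\<close>. Its length is 4 or 6; length 6 yields
    \<open>J13\<close>, length 4 yields \<open>J14\<close> or \<open>J15\<close>.
\<close>

(* The arrow of function sets would make every arc written with it ambiguous. *)
unbundle no funcset_syntax

section \<open>Copies of a small digraph as tuples of vertices\<close>

lemma ex_list_length_Suc:
  "(\<exists>xs. length xs = Suc n \<and> P xs) \<longleftrightarrow> (\<exists>x xs. length xs = n \<and> P (x # xs))"
  by (metis length_Suc_conv)

text \<open>
  As \<open>D\<close> has no parallel arcs, an injection on the vertices that preserves arcs
  determines the subdigraph: its arcs are those over the images of \<open>A\<close>.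
\<close>
lemma contains_copy_iff_embedding:
  assumes "nomulti_digraph D"
  shows "contains_copy D (digraph_of_arcs A) \<longleftrightarrow>
    (\<exists>g. inj_on g (fst ` A \<union> snd ` A) \<and> (\<forall>(u, v)\<in>A. g u \<rightarrow>\<^bsub>D\<^esub> g v))"
    (is "_ \<longleftrightarrow> (\<exists>g. ?embedding g)")
proof
  let ?V = "fst ` A \<union> snd ` A"
  interpret D: nomulti_digraph D by fact
  assume "contains_copy D (digraph_of_arcs A)"
  then obtain H f where H: "subgraph H D" and f: "pre_digraph.digraph_isomorphism H f"
    and J: "digraph_of_arcs A = app_iso f H"
    unfolding contains_copy_def digraph_iso_def by blast
  have V: "iso_verts f ` verts H = ?V" and E: "iso_arcs f ` arcs H = A"
    and tail: "iso_tail f = fst" and head: "iso_head f = snd"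
    using arg_cong[OF J, of verts] arg_cong[OF J, of arcs]
      arg_cong[OF J, of tail] arg_cong[OF J, of head]
    by (simp_all add: digraph_of_arcs_def)
  have inj: "inj_on (iso_verts f) (verts H)"
    using f by (simp add: pre_digraph.digraph_isomorphism_def)
  define g where "g = the_inv_into (verts H) (iso_verts f)"
  have "inj_on g ?V"
    using inj_on_the_inv_into[OF inj] by (simp add: g_def V)
  moreover have "g u \<rightarrow>\<^bsub>D\<^esub> g v" if "(u, v) \<in> A" for u v
  proof -
    obtain e where e: "e \<in> arcs H" "iso_arcs f e = (u, v)"
      using E \<open>(u, v) \<in> A\<close> by (metis imageE)
    have "e \<in> arcs D" "tail D e = tail H e" "head D e = head H e"
      and wf: "wf_digraph H"
      using H e by (auto simp: subgraph_def compatible_def)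
    have "iso_verts f (tail H e) = u" "iso_verts f (head H e) = v"
      using f e tail head by (simp_all add: pre_digraph.digraph_isomorphism_def)
    then have "g u = tail H e" "g v = head H e"
      using the_inv_into_f_f[OF inj] wf_digraph.tail_in_verts[OF wf e(1)]
        wf_digraph.head_in_verts[OF wf e(1)] by (auto simp: g_def)
    then show ?thesis
      using D.dominatesI[of e] \<open>e \<in> arcs D\<close> \<open>tail D e = tail H e\<close> \<open>head D e = head H e\<close>
      by (simp add: arc_to_ends_def)
  qed
  ultimately show "\<exists>g. ?embedding g" by blast
next
  let ?V = "fst ` A \<union> snd ` A"
  interpret D: nomulti_digraph D by fact
  assume "\<exists>g. ?embedding g"
  then obtain g where inj: "inj_on g ?V"
    and g: "\<And>u v. (u, v) \<in> A \<Longrightarrow> g u \<rightarrow>\<^bsub>D\<^esub> g v" by blast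
  (* Records are compared with total functions for tails and heads, so the isomorphism
     goes from the subdigraph of D to the concrete digraph, whose tails and heads are projections. *)
  define h where "h = the_inv_into ?V g"
  have hg: "h (g u) = u" if "u \<in> ?V" for u
    unfolding h_def using inj that by (rule the_inv_into_f_f)
  define H where "H = D \<lparr>verts := g ` ?V,
    arcs := {e \<in> arcs D. \<exists>(u, v)\<in>A. tail D e = g u \<and> head D e = g v}\<rparr>"
  define f where "f = \<lparr>iso_verts = h, iso_arcs = (\<lambda>e. (h (tail D e), h (head D e))),
    iso_head = snd, iso_tail = fst\<rparr>"
  have ends: "(h (tail D e), h (head D e)) \<in> A"
    and tail: "tail D e = g (h (tail D e))" and head: "head D e = g (h (head D e))"
    if "e \<in> arcs H" for e
  proof -
    obtain u v where uv: "(u, v) \<in> A" "tail D e = g u" "head D e = g v"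
      using \<open>e \<in> arcs H\<close> by (auto simp: H_def)
    moreover have "u \<in> ?V" "v \<in> ?V"
      using uv(1) by force+
    ultimately show "(h (tail D e), h (head D e)) \<in> A"
      "tail D e = g (h (tail D e))" "head D e = g (h (head D e))"
      using hg by auto
  qed
  have wf: "wf_digraph H"
    by unfold_locales (force simp: H_def)+
  have "inj_on (iso_arcs f) (arcs H)"
  proof (rule inj_onI)
    fix e e'
    assume e: "e \<in> arcs H" "e' \<in> arcs H" and "iso_arcs f e = iso_arcs f e'"
    then have "tail D e = tail D e'" "head D e = head D e'"
      using tail[OF e(1)] tail[OF e(2)] head[OF e(1)] head[OF e(2)] by (simp_all add: f_def)
    then show "e = e'"
      using e D.no_multi_arcs[of e e'] by (simp add: arc_to_ends_def H_def)
  qed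
  moreover have "inj_on h (g ` ?V)"
    unfolding h_def using inj by (rule inj_on_the_inv_into)
  ultimately have "pre_digraph.digraph_isomorphism H f"
    using wf by (simp add: pre_digraph.digraph_isomorphism_def f_def H_def)
  moreover have "digraph_of_arcs A = app_iso f H"
  proof -
    have "h ` g ` ?V = ?V"
      using hg by (force simp: image_image)
    moreover have "(\<lambda>e. (h (tail D e), h (head D e))) ` arcs H = A"
    proof (intro equalityI subsetI)
      fix a assume "a \<in> A"
      moreover obtain u v where "a = (u, v)" by fastforce
      ultimately obtain e where "e \<in> arcs D" "tail D e = g u" "head D e = g v"
        using g by blast
      moreover have "e \<in> arcs H"
        using calculation \<open>a \<in> A\<close> \<open>a = (u, v)\<close> by (auto simp: H_def)
      moreover have "u \<in> ?V" "v \<in> ?V"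
        using \<open>a \<in> A\<close> \<open>a = (u, v)\<close> by force+
      ultimately show "a \<in> (\<lambda>e. (h (tail D e), h (head D e))) ` arcs H"
        using hg[of u] hg[of v] \<open>a = (u, v)\<close> by (intro image_eqI[of _ _ e]) simp_all
    next
      fix a assume "a \<in> (\<lambda>e. (h (tail D e), h (head D e))) ` arcs H"
      then show "a \<in> A"
        by (rule imageE) (simp add: ends)
    qed
    moreover have "verts H = g ` ?V"
      by (simp add: H_def)
    ultimately show ?thesis
      unfolding digraph_of_arcs_def app_iso_def by (simp add: f_def del: image_Un)
  qed
  moreover have "subgraph H D"
  proof -
    have "g u \<in> verts D" "g v \<in> verts D" if "(u, v) \<in> A" for u v
      using D.adj_in_verts[OF g[OF that]] by blast+
    then have "verts H \<subseteq> verts D"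
      by (auto simp: H_def)
    then show ?thesis
      using wf D.wf_digraph by (auto simp: subgraph_def H_def compatible_def)
  qed
  ultimately show "contains_copy D (digraph_of_arcs A)"
    unfolding contains_copy_def digraph_iso_def by blast
qed

text \<open>
  For a concrete digraph this turns the embedding into a list of values for the list \<open>vs\<close> of its
  vertex names, so that the simplifier can unfold it to a statement about finitely many vertices of
  \<open>D\<close>.
\<close>
lemma contains_copy_iff_list:
  assumes "nomulti_digraph D" and vs: "distinct vs" "set vs = fst ` A \<union> snd ` A"
  shows "contains_copy D (digraph_of_arcs A) \<longleftrightarrow>
    (\<exists>xs. length xs = length vs \<and> distinct xs \<and>
      (\<forall>(u, v)\<in>A. the (map_of (zip vs xs) u) \<rightarrow>\<^bsub>D\<^esub> the (map_of (zip vs xs) v)))"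
    (is "_ \<longleftrightarrow> (\<exists>xs. ?list xs)")
  unfolding contains_copy_iff_embedding[OF assms(1)] vs(2)[symmetric]
proof
  assume "\<exists>g. inj_on g (set vs) \<and> (\<forall>(u, v)\<in>A. g u \<rightarrow>\<^bsub>D\<^esub> g v)"
  then obtain g where g: "inj_on g (set vs)" "\<forall>(u, v)\<in>A. g u \<rightarrow>\<^bsub>D\<^esub> g v" by blast
  have "the (map_of (zip vs (map g vs)) u) = g u" if "u \<in> set vs" for u
    using that by (simp add: map_of_zip_map)
  moreover have "u \<in> set vs" "v \<in> set vs" if "(u, v) \<in> A" for u v
    using vs(2) that by force+
  ultimately have "?list (map g vs)"
    using g vs(1) by (auto simp: distinct_map split: prod.splits)
  then show "\<exists>xs. ?list xs" by blast
next
  assume "\<exists>xs. ?list xs"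
  then obtain xs where xs: "?list xs" by blast
  define g where "g u = the (map_of (zip vs xs) u)" for u
  have "map g vs = xs"
    using xs vs(1) by (intro nth_equalityI) (auto simp: g_def map_of_zip_nth)
  then have "inj_on g (set vs)"
    using xs by (metis distinct_map)
  then show "\<exists>g. inj_on g (set vs) \<and> (\<forall>(u, v)\<in>A. g u \<rightarrow>\<^bsub>D\<^esub> g v)"
    using xs unfolding g_def by blast
qed

lemmas list_witnesses =
  list.size ex_list_length_Suc add_0_right add_Suc_right length_0_conv

context nomulti_digraph
begin

lemma contains_TT3_iff:
  "contains_copy G TT3 \<longleftrightarrow> (\<exists>a b c.
    distinct [a, b, c] \<and>
    a \<rightarrow> b \<and> b \<rightarrow> c \<and> a \<rightarrow> c)"
  unfolding TT3_def
  by (subst contains_copy_iff_list[OF nomulti_digraph,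
        of "[''a'', ''b'', ''c'']"])
    (simp, (rule equalityI; simp), simp only: list_witnesses, simp)

lemma contains_J1_iff:
  "contains_copy G J1 \<longleftrightarrow> (\<exists>p q a b c.
    distinct [p, q, a, b, c] \<and>
    p \<rightarrow> a \<and> q \<rightarrow> a \<and> p \<rightarrow> b \<and> q \<rightarrow> b \<and> a \<rightarrow> c)"
  unfolding J1_def
  by (subst contains_copy_iff_list[OF nomulti_digraph,
        of "[''p'', ''q'', ''a'', ''b'', ''c'']"])
    (simp, (rule equalityI; simp), simp only: list_witnesses, simp)

lemma contains_J2_iff:
  "contains_copy G J2 \<longleftrightarrow> (\<exists>p q r a b.
    distinct [p, q, r, a, b] \<and>
    p \<rightarrow> a \<and> q \<rightarrow> a \<and> a \<rightarrow> b \<and> r \<rightarrow> b \<and> b \<rightarrow> p \<and> q \<rightarrow> r)"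
  unfolding J2_def
  by (subst contains_copy_iff_list[OF nomulti_digraph,
        of "[''p'', ''q'', ''r'', ''a'', ''b'']"])
    (simp, (rule equalityI; simp), simp only: list_witnesses, simp)

lemma contains_J3_iff:
  "contains_copy G J3 \<longleftrightarrow> (\<exists>p q r a b.
    distinct [p, q, r, a, b] \<and>
    p \<rightarrow> a \<and> q \<rightarrow> a \<and> a \<rightarrow> b \<and> r \<rightarrow> b \<and> b \<rightarrow> p \<and> r \<rightarrow> q)"
  unfolding J3_def
  by (subst contains_copy_iff_list[OF nomulti_digraph,
        of "[''p'', ''q'', ''r'', ''a'', ''b'']"])
    (simp, (rule equalityI; simp), simp only: list_witnesses, simp)

lemma contains_J4_iff:
  "contains_copy G J4 \<longleftrightarrow> (\<exists>s p q a b.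
    distinct [s, p, q, a, b] \<and>
    s \<rightarrow> a \<and> p \<rightarrow> a \<and> s \<rightarrow> b \<and> q \<rightarrow> b \<and> a \<rightarrow> q \<and> b \<rightarrow> p)"
  unfolding J4_def
  by (subst contains_copy_iff_list[OF nomulti_digraph,
        of "[''s'', ''p'', ''q'', ''a'', ''b'']"])
    (simp, (rule equalityI; simp), simp only: list_witnesses, simp)

lemma contains_J5_iff:
  "contains_copy G J5 \<longleftrightarrow> (\<exists>s p q a b d.
    distinct [s, p, q, a, b, d] \<and>
    s \<rightarrow> a \<and> p \<rightarrow> a \<and> s \<rightarrow> b \<and> q \<rightarrow> b \<and> a \<rightarrow> q \<and> b \<rightarrow> d \<and> p \<rightarrow> d)"
  unfolding J5_def
  by (subst contains_copy_iff_list[OF nomulti_digraph,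
        of "[''s'', ''p'', ''q'', ''a'', ''b'', ''d'']"])
    (simp, (rule equalityI; simp), simp only: list_witnesses, simp)

lemma contains_J6_iff:
  "contains_copy G J6 \<longleftrightarrow> (\<exists>s p q a b c.
    distinct [s, p, q, a, b, c] \<and>
    s \<rightarrow> a \<and> p \<rightarrow> a \<and> s \<rightarrow> b \<and> q \<rightarrow> b \<and> a \<rightarrow> c \<and> b \<rightarrow> c \<and> p \<rightarrow> q)"
  unfolding J6_def
  by (subst contains_copy_iff_list[OF nomulti_digraph,
        of "[''s'', ''p'', ''q'', ''a'', ''b'', ''c'']"])
    (simp, (rule equalityI; simp), simp only: list_witnesses, simp)

lemma contains_J7_iff:
  "contains_copy G J7 \<longleftrightarrow> (\<exists>p q r a b c.
    distinct [p, q, r, a, b, c] \<and>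
    p \<rightarrow> a \<and> q \<rightarrow> a \<and> a \<rightarrow> b \<and> r \<rightarrow> b \<and> b \<rightarrow> c \<and> p \<rightarrow> c \<and> r \<rightarrow> q)"
  unfolding J7_def
  by (subst contains_copy_iff_list[OF nomulti_digraph,
        of "[''p'', ''q'', ''r'', ''a'', ''b'', ''c'']"])
    (simp, (rule equalityI; simp), simp only: list_witnesses, simp)

lemma contains_J8_iff:
  "contains_copy G J8 \<longleftrightarrow> (\<exists>p q r a b c.
    distinct [p, q, r, a, b, c] \<and>
    p \<rightarrow> a \<and> q \<rightarrow> a \<and> a \<rightarrow> b \<and> r \<rightarrow> b \<and> b \<rightarrow> c \<and> p \<rightarrow> c \<and> q \<rightarrow> r)"
  unfolding J8_def
  by (subst contains_copy_iff_list[OF nomulti_digraph,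
        of "[''p'', ''q'', ''r'', ''a'', ''b'', ''c'']"])
    (simp, (rule equalityI; simp), simp only: list_witnesses, simp)

lemma contains_J9_iff:
  "contains_copy G J9 \<longleftrightarrow> (\<exists>p q r a b d.
    distinct [p, q, r, a, b, d] \<and>
    p \<rightarrow> a \<and> q \<rightarrow> a \<and> a \<rightarrow> b \<and> r \<rightarrow> b \<and> b \<rightarrow> p \<and> q \<rightarrow> d \<and> r \<rightarrow> d)"
  unfolding J9_def
  by (subst contains_copy_iff_list[OF nomulti_digraph,
        of "[''p'', ''q'', ''r'', ''a'', ''b'', ''d'']"])
    (simp, (rule equalityI; simp), simp only: list_witnesses, simp)

lemma contains_J10_iff:
  "contains_copy G J10 \<longleftrightarrow> (\<exists>p q r a b c d.
    distinct [p, q, r, a, b, c, d] \<and>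
    p \<rightarrow> a \<and> q \<rightarrow> a \<and> a \<rightarrow> b \<and> r \<rightarrow> b \<and> b \<rightarrow> c \<and> p \<rightarrow> c \<and> q \<rightarrow> d \<and> r \<rightarrow> d)"
  unfolding J10_def
  by (subst contains_copy_iff_list[OF nomulti_digraph,
        of "[''p'', ''q'', ''r'', ''a'', ''b'', ''c'', ''d'']"])
    (simp, (rule equalityI; simp), simp only: list_witnesses, simp)

lemma contains_J11_iff:
  "contains_copy G J11 \<longleftrightarrow> (\<exists>s p q a b c d.
    distinct [s, p, q, a, b, c, d] \<and>
    s \<rightarrow> a \<and> p \<rightarrow> a \<and> s \<rightarrow> b \<and> q \<rightarrow> b \<and> a \<rightarrow> c \<and> b \<rightarrow> c \<and> p \<rightarrow> d \<and> q \<rightarrow> d)"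
  unfolding J11_def
  by (subst contains_copy_iff_list[OF nomulti_digraph,
        of "[''s'', ''p'', ''q'', ''a'', ''b'', ''c'', ''d'']"])
    (simp, (rule equalityI; simp), simp only: list_witnesses, simp)

lemma contains_J12_iff:
  "contains_copy G J12 \<longleftrightarrow> (\<exists>s p q a b c d.
    distinct [s, p, q, a, b, c, d] \<and>
    s \<rightarrow> a \<and> p \<rightarrow> a \<and> s \<rightarrow> b \<and> q \<rightarrow> b \<and> a \<rightarrow> c \<and> q \<rightarrow> c \<and> b \<rightarrow> d \<and> p \<rightarrow> d)"
  unfolding J12_def
  by (subst contains_copy_iff_list[OF nomulti_digraph,
        of "[''s'', ''p'', ''q'', ''a'', ''b'', ''c'', ''d'']"])
    (simp, (rule equalityI; simp), simp only: list_witnesses, simp)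

lemma contains_J13_iff:
  "contains_copy G J13 \<longleftrightarrow> (\<exists>c1 c2 c3 c4 c5 c6 v1 v2 v3.
    distinct [c1, c2, c3, c4, c5, c6, v1, v2, v3] \<and>
    c1 \<rightarrow> c2 \<and> c2 \<rightarrow> c3 \<and> c3 \<rightarrow> c4 \<and> c4 \<rightarrow> c5 \<and> c5 \<rightarrow> c6 \<and> c6 \<rightarrow> c1 \<and> v1 \<rightarrow> c1 \<and> v1 \<rightarrow> c4 \<and>
    v2 \<rightarrow> c2 \<and> v2 \<rightarrow> c5 \<and> v3 \<rightarrow> c3 \<and> v3 \<rightarrow> c6)"
  unfolding J13_def
  by (subst contains_copy_iff_list[OF nomulti_digraph,
        of "[''c1'', ''c2'', ''c3'', ''c4'', ''c5'', ''c6'', ''v1'', ''v2'', ''v3'']"])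
    (simp, (rule equalityI; simp), simp only: list_witnesses, simp)

lemma contains_J14_iff:
  "contains_copy G J14 \<longleftrightarrow> (\<exists>c1 c2 c3 c4 e1 e2 e3 e4 f.
    distinct [c1, c2, c3, c4, e1, e2, e3, e4, f] \<and>
    c1 \<rightarrow> c2 \<and> c2 \<rightarrow> c3 \<and> c3 \<rightarrow> c4 \<and> c4 \<rightarrow> c1 \<and> e1 \<rightarrow> c1 \<and> e2 \<rightarrow> c2 \<and> e3 \<rightarrow> c3 \<and> e4 \<rightarrow> c4 \<and>
    e3 \<rightarrow> e1 \<and> f \<rightarrow> e1 \<and> e2 \<rightarrow> f \<and> e4 \<rightarrow> f)"
  unfolding J14_def
  by (subst contains_copy_iff_list[OF nomulti_digraph,
        of "[''c1'', ''c2'', ''c3'', ''c4'', ''e1'', ''e2'', ''e3'', ''e4'', ''f'']"])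
    (simp, (rule equalityI; simp), simp only: list_witnesses, simp)

lemma contains_J15_iff:
  "contains_copy G J15 \<longleftrightarrow> (\<exists>c1 c2 c3 c4 e1 e2 e3 e4 f.
    distinct [c1, c2, c3, c4, e1, e2, e3, e4, f] \<and>
    c1 \<rightarrow> c2 \<and> c2 \<rightarrow> c3 \<and> c3 \<rightarrow> c4 \<and> c4 \<rightarrow> c1 \<and> e1 \<rightarrow> c1 \<and> e2 \<rightarrow> c2 \<and> e3 \<rightarrow> c3 \<and> e4 \<rightarrow> c4 \<and>
    e3 \<rightarrow> e1 \<and> f \<rightarrow> e1 \<and> e4 \<rightarrow> e2 \<and> f \<rightarrow> e2)"
  unfolding J15_def
  by (subst contains_copy_iff_list[OF nomulti_digraph,
        of "[''c1'', ''c2'', ''c3'', ''c4'', ''e1'', ''e2'', ''e3'', ''e4'', ''f'']"])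
    (simp, (rule equalityI; simp), simp only: list_witnesses, simp)

end

section \<open>Closed in-neighbourhoods in 2-in-regular digraphs\<close>

locale two_in_regular_digraph = loopfree_digraph + nomulti_digraph +
  assumes two_in_regular: "in_regular 2 G"
begin

abbreviation N :: "'a \<Rightarrow> 'a set" where
  "N \<equiv> closed_in_nbrs G"

lemma in_N_iff: "v \<in> N u \<longleftrightarrow> v = u \<or> v \<rightarrow> u"
  by (auto simp: closed_in_nbrs_def in_nbrs_def)

lemma N_cases:
  assumes "a \<in> verts G"
  obtains p q where "N a = {a, p, q}" "p \<rightarrow> a" "q \<rightarrow> a" "distinct [a, p, q]"
proof -
  obtain p q where pq: "in_nbrs G a = {p, q}" "p \<noteq> q"
    using two_in_regular assms by (auto simp: in_regular_def card_2_iff)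
  then have "p \<rightarrow> a" "q \<rightarrow> a"
    by (auto simp: in_nbrs_def)
  with pq that[of p q] show thesis
    using adj_not_same by (auto simp: closed_in_nbrs_def)
qed

lemma card_N: "a \<in> verts G \<Longrightarrow> card (N a) = 3"
  by (erule N_cases) simp

lemma N_eqI:
  assumes "p \<rightarrow> a" "q \<rightarrow> a" "p \<noteq> q"
  shows "N a = {a, p, q}"
proof -
  have "a \<in> verts G"
    using adj_in_verts assms(1) by blast
  then obtain p' q' where "N a = {a, p', q'}" "distinct [a, p', q']"
    using N_cases by blast
  moreover have "p \<in> N a" "q \<in> N a" "p \<noteq> a" "q \<noteq> a"
    using assms adj_not_same by (auto simp: in_N_iff)
  ultimately show ?thesis
    using assms(3) by auto
qed

lemma second_in_nbr:
  assumes "u \<rightarrow> v"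
  obtains w where "w \<rightarrow> v" "N v = {v, u, w}"
proof -
  have "v \<in> verts G"
    using adj_in_verts assms by blast
  then obtain p q where "N v = {v, p, q}" "p \<rightarrow> v" "q \<rightarrow> v" "distinct [v, p, q]"
    using N_cases by blast
  moreover have "u \<in> N v" "u \<noteq> v"
    using assms adj_not_same by (auto simp: in_N_iff)
  ultimately show thesis
    using that[of p] that[of q] by (auto simp: insert_commute)
qed

lemma N_subset_verts: "a \<in> verts G \<Longrightarrow> N a \<subseteq> verts G"
  using adj_in_verts by (auto simp: in_N_iff)

text \<open>
  Intersecting with a larger code separates more pairs, and the set of all vertices is the largest.
\<close>
lemma admits_iff_separated:
  "admits_identifying_code G 3 \<longleftrightarrow>
    (\<forall>X Y. X \<subseteq> verts G \<and> Y \<subseteq> verts G \<and> card X \<in> {1..3} \<and> card Y \<in> {1..3} \<and>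
      \<Union>(N ` X) = \<Union>(N ` Y) \<longrightarrow> X = Y)"
    (is "_ \<longleftrightarrow> ?separated")
proof
  assume "admits_identifying_code G 3"
  then show ?separated
    unfolding admits_identifying_code_def identifying_code_def closed_in_nbrs_set_def
    by (metis (no_types, lifting) atLeastAtMost_iff)
next
  assume *: ?separated
  have "\<Union>(N ` X) \<inter> verts G = \<Union>(N ` X)" if "X \<subseteq> verts G" for X
    using that N_subset_verts by blast
  then have "identifying_code G 3 (verts G)"
    unfolding identifying_code_def closed_in_nbrs_set_def
    using * by (metis atLeastAtMost_iff subset_refl)
  then show "admits_identifying_code G 3"
    unfolding admits_identifying_code_def by blast
qed

section \<open>Forbidden configurations rule out identifying codes\<close>

lemma not_admits_if_covered:
  assumes "x \<noteq> y" "x \<noteq> z" "{x, y, z} \<subseteq> verts G" "N x \<subseteq> N y \<union> N z"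
  shows "\<not> admits_identifying_code G 3"
proof -
  have "card {x, y, z} \<in> {1..3}" "card {y, z} \<in> {1..3}" "{x, y, z} \<noteq> {y, z}"
    using assms by (auto simp: card_insert_if)
  moreover have "\<Union>(N ` {x, y, z}) = \<Union>(N ` {y, z})"
    using assms(4) by auto
  ultimately show ?thesis
    unfolding admits_iff_separated using assms(3) by (metis insert_subset)
qed

text \<open>
  The sets \<open>{a, z, w}\<close> and \<open>{b, z, w}\<close> clash: what only \<open>N a\<close> or only \<open>N b\<close> contains is covered by \<open>N z\<close>
  and \<open>N w\<close>. A converse for five distinct vertices \<open>s\<close>, \<open>p\<close>, \<open>q\<close>, \<open>p'\<close>, \<open>q'\<close>
  is \<open>no_exchange\<close> below.
\<close>
lemma not_admits_if_exchangeable: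
  assumes "a \<noteq> b" "a \<noteq> z" "a \<noteq> w" "{a, b, z, w} \<subseteq> verts G"
    and "N a = {s, p, q}" "N b = {s, p', q'}"
    and "p \<in> N z" "p' \<in> N z" "q \<in> N w" "q' \<in> N w"
  shows "\<not> admits_identifying_code G 3"
proof -
  have "card {a, z, w} \<in> {1..3}" "card {b, z, w} \<in> {1..3}" "{a, z, w} \<noteq> {b, z, w}"
    using assms by (auto simp: card_insert_if)
  moreover have "\<Union>(N ` {a, z, w}) = \<Union>(N ` {b, z, w})"
    using assms(5-) by auto
  ultimately show ?thesis
    unfolding admits_iff_separated using assms(4) by (metis insert_subset)
qed

lemma not_admits_if_triples:
  assumes "distinct [x1, x2, x3]" "distinct [y1, y2, y3]" "x1 \<notin> {y1, y2, y3}"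
    and "{x1, x2, x3, y1, y2, y3} \<subseteq> verts G"
    and "N x1 \<union> N x2 \<union> N x3 = N y1 \<union> N y2 \<union> N y3"
  shows "\<not> admits_identifying_code G 3"
proof -
  have "card {x1, x2, x3} \<in> {1..3}" "card {y1, y2, y3} \<in> {1..3}"
    "{x1, x2, x3} \<noteq> {y1, y2, y3}"
    using assms by auto
  moreover have "\<Union>(N ` {x1, x2, x3}) = \<Union>(N ` {y1, y2, y3})"
    using assms(5) by (simp add: Un_assoc)
  ultimately show ?thesis
    unfolding admits_iff_separated using assms(4) by (metis insert_subset)
qed

text \<open>
  Let \<open>w\<close> be the other in-neighbour of \<open>u\<close>. As \<open>v\<close> covers \<open>u\<close> and itself, \<open>N u\<close> is contained in
  \<open>N v \<union> N w\<close>.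
\<close>
lemma not_admits_if_digon:
  assumes "u \<rightarrow> v" "v \<rightarrow> u"
  shows "\<not> admits_identifying_code G 3"
proof -
  have verts: "u \<in> verts G" "v \<in> verts G"
    using adj_in_verts assms by blast+
  obtain w where w: "w \<rightarrow> u" "N u = {u, v, w}"
    using second_in_nbr[OF assms(2)] by blast
  moreover have "w \<in> verts G" "w \<noteq> u" "u \<noteq> v"
    using adj_in_verts w(1) adj_not_same assms(1) by blast+
  ultimately show ?thesis
    using assms(1) verts by (intro not_admits_if_covered[of u v w]) (auto simp: in_N_iff)
qed

text \<open>
  The sink \<open>c\<close> covers \<open>a\<close> and \<open>b\<close>, so only the second in-neighbour of \<open>b\<close> is left to cover in \<open>N b\<close>.
\<close>
lemma not_admits_if_TT3:
  assumes "contains_copy G TT3"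
  shows "\<not> admits_identifying_code G 3"
proof -
  obtain a b c where abc: "distinct [a, b, c]" "a \<rightarrow> b" "b \<rightarrow> c" "a \<rightarrow> c"
    using assms unfolding contains_TT3_iff by blast
  then have "b \<in> verts G" "c \<in> verts G"
    using adj_in_verts by blast+
  obtain z where z: "z \<rightarrow> b" "N b = {b, a, z}"
    using second_in_nbr[OF abc(2)] by blast
  moreover have "z \<in> verts G" "z \<noteq> b"
    using adj_in_verts z(1) adj_not_same by blast+
  ultimately show ?thesis
    using abc \<open>b \<in> verts G\<close> \<open>c \<in> verts G\<close>
    by (intro not_admits_if_covered[of b c z]) (auto simp: in_N_iff)
qed

text \<open>
  In every \<open>J\<close> the closed in-neighbourhoods of the vertices with two incoming arcs are known
  completely, since \<open>D\<close> adds no further in-neighbours. They suffice to exhibit two clashing sets.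
\<close>
lemma not_admits_if_forbidden:
  assumes "J \<in> forbidden_digraphs" "contains_copy G J"
  shows "\<not> admits_identifying_code G 3"
proof -
  have "\<not> admits_identifying_code G 3" if J: "contains_copy G J1"
  proof -
    obtain p q a b c where copy:
      "distinct [p, q, a, b, c] \<and>
        p \<rightarrow> a \<and> q \<rightarrow> a \<and> p \<rightarrow> b \<and> q \<rightarrow> b \<and> a \<rightarrow> c"
      using contains_J1_iff[THEN iffD1, OF J] by (elim exE)
    have nbds: "N a = {a, p, q}" "N b = {b, p, q}"
      by (rule N_eqI; use copy in auto)+
    show ?thesis
      by (rule not_admits_if_covered[of a b c])
        (use copy in \<open>auto simp: nbds in_N_iff adj_in_verts insert_commute\<close>)
  qed
  moreover
  have "\<not> admits_identifying_code G 3" if J: "contains_copy G J2"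
  proof -
    obtain p q r a b where copy:
      "distinct [p, q, r, a, b] \<and>
        p \<rightarrow> a \<and> q \<rightarrow> a \<and> a \<rightarrow> b \<and> r \<rightarrow> b \<and> b \<rightarrow> p \<and> q \<rightarrow> r"
      using contains_J2_iff[THEN iffD1, OF J] by (elim exE)
    have nbds: "N a = {a, p, q}" "N b = {b, a, r}"
      by (rule N_eqI; use copy in auto)+
    show ?thesis
      by (rule not_admits_if_exchangeable[of a b p r a p q b r])
        (use copy in \<open>auto simp: nbds in_N_iff adj_in_verts insert_commute\<close>)
  qed
  moreover
  have "\<not> admits_identifying_code G 3" if J: "contains_copy G J3"
  proof -
    obtain p q r a b where copy:
      "distinct [p, q, r, a, b] \<and>
        p \<rightarrow> a \<and> q \<rightarrow> a \<and> a \<rightarrow> b \<and> r \<rightarrow> b \<and> b \<rightarrow> p \<and> r \<rightarrow> q"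
      using contains_J3_iff[THEN iffD1, OF J] by (elim exE)
    have nbds: "N a = {a, p, q}" "N b = {b, a, r}"
      by (rule N_eqI; use copy in auto)+
    show ?thesis
      by (rule not_admits_if_exchangeable[of a b p q a p q b r])
        (use copy in \<open>auto simp: nbds in_N_iff adj_in_verts insert_commute\<close>)
  qed
  moreover
  have "\<not> admits_identifying_code G 3" if J: "contains_copy G J4"
  proof -
    obtain s p q a b where copy:
      "distinct [s, p, q, a, b] \<and>
        s \<rightarrow> a \<and> p \<rightarrow> a \<and> s \<rightarrow> b \<and> q \<rightarrow> b \<and> a \<rightarrow> q \<and> b \<rightarrow> p"
      using contains_J4_iff[THEN iffD1, OF J] by (elim exE)
    have nbds: "N a = {a, s, p}" "N b = {b, s, q}"
      by (rule N_eqI; use copy in auto)+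
    show ?thesis
      by (rule not_admits_if_exchangeable[of a b q p s a p q b])
        (use copy in \<open>auto simp: nbds in_N_iff adj_in_verts insert_commute\<close>)
  qed
  moreover
  have "\<not> admits_identifying_code G 3" if J: "contains_copy G J5"
  proof -
    obtain s p q a b d where copy:
      "distinct [s, p, q, a, b, d] \<and>
        s \<rightarrow> a \<and> p \<rightarrow> a \<and> s \<rightarrow> b \<and> q \<rightarrow> b \<and> a \<rightarrow> q \<and> b \<rightarrow> d \<and> p \<rightarrow> d"
      using contains_J5_iff[THEN iffD1, OF J] by (elim exE)
    have nbds: "N a = {a, s, p}" "N b = {b, s, q}"
      by (rule N_eqI; use copy in auto)+
    show ?thesis
      by (rule not_admits_if_exchangeable[of a b q d s a p q b])
        (use copy in \<open>auto simp: nbds in_N_iff adj_in_verts insert_commute\<close>)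
  qed
  moreover
  have "\<not> admits_identifying_code G 3" if J: "contains_copy G J6"
  proof -
    obtain s p q a b c where copy:
      "distinct [s, p, q, a, b, c] \<and>
        s \<rightarrow> a \<and> p \<rightarrow> a \<and> s \<rightarrow> b \<and> q \<rightarrow> b \<and> a \<rightarrow> c \<and> b \<rightarrow> c \<and> p \<rightarrow> q"
      using contains_J6_iff[THEN iffD1, OF J] by (elim exE)
    have nbds: "N a = {a, s, p}" "N b = {b, s, q}"
      by (rule N_eqI; use copy in auto)+
    show ?thesis
      by (rule not_admits_if_exchangeable[of a b c q s a p b q])
        (use copy in \<open>auto simp: nbds in_N_iff adj_in_verts insert_commute\<close>)
  qed
  moreover
  have "\<not> admits_identifying_code G 3" if J: "contains_copy G J7"
  proof -
    obtain p q r a b c where copy: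
      "distinct [p, q, r, a, b, c] \<and>
        p \<rightarrow> a \<and> q \<rightarrow> a \<and> a \<rightarrow> b \<and> r \<rightarrow> b \<and> b \<rightarrow> c \<and> p \<rightarrow> c \<and> r \<rightarrow> q"
      using contains_J7_iff[THEN iffD1, OF J] by (elim exE)
    have nbds: "N a = {a, p, q}" "N b = {b, a, r}"
      by (rule N_eqI; use copy in auto)+
    show ?thesis
      by (rule not_admits_if_exchangeable[of a b c q a p q b r])
        (use copy in \<open>auto simp: nbds in_N_iff adj_in_verts insert_commute\<close>)
  qed
  moreover
  have "\<not> admits_identifying_code G 3" if J: "contains_copy G J8"
  proof -
    obtain p q r a b c where copy:
      "distinct [p, q, r, a, b, c] \<and>
        p \<rightarrow> a \<and> q \<rightarrow> a \<and> a \<rightarrow> b \<and> r \<rightarrow> b \<and> b \<rightarrow> c \<and> p \<rightarrow> c \<and> q \<rightarrow> r"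
      using contains_J8_iff[THEN iffD1, OF J] by (elim exE)
    have nbds: "N a = {a, p, q}" "N b = {b, a, r}"
      by (rule N_eqI; use copy in auto)+
    show ?thesis
      by (rule not_admits_if_exchangeable[of a b c r a p q b r])
        (use copy in \<open>auto simp: nbds in_N_iff adj_in_verts insert_commute\<close>)
  qed
  moreover
  have "\<not> admits_identifying_code G 3" if J: "contains_copy G J9"
  proof -
    obtain p q r a b d where copy:
      "distinct [p, q, r, a, b, d] \<and>
        p \<rightarrow> a \<and> q \<rightarrow> a \<and> a \<rightarrow> b \<and> r \<rightarrow> b \<and> b \<rightarrow> p \<and> q \<rightarrow> d \<and> r \<rightarrow> d"
      using contains_J9_iff[THEN iffD1, OF J] by (elim exE)
    have nbds: "N a = {a, p, q}" "N b = {b, a, r}"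
      by (rule N_eqI; use copy in auto)+
    show ?thesis
      by (rule not_admits_if_exchangeable[of a b p d a p q b r])
        (use copy in \<open>auto simp: nbds in_N_iff adj_in_verts insert_commute\<close>)
  qed
  moreover
  have "\<not> admits_identifying_code G 3" if J: "contains_copy G J10"
  proof -
    obtain p q r a b c d where copy:
      "distinct [p, q, r, a, b, c, d] \<and>
        p \<rightarrow> a \<and> q \<rightarrow> a \<and> a \<rightarrow> b \<and> r \<rightarrow> b \<and> b \<rightarrow> c \<and> p \<rightarrow> c \<and> q \<rightarrow> d \<and> r \<rightarrow> d"
      using contains_J10_iff[THEN iffD1, OF J] by (elim exE)
    have nbds: "N a = {a, p, q}" "N b = {b, a, r}"
      by (rule N_eqI; use copy in auto)+
    show ?thesis
      by (rule not_admits_if_exchangeable[of a b c d a p q b r])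
        (use copy in \<open>auto simp: nbds in_N_iff adj_in_verts insert_commute\<close>)
  qed
  moreover
  have "\<not> admits_identifying_code G 3" if J: "contains_copy G J11"
  proof -
    obtain s p q a b c d where copy:
      "distinct [s, p, q, a, b, c, d] \<and>
        s \<rightarrow> a \<and> p \<rightarrow> a \<and> s \<rightarrow> b \<and> q \<rightarrow> b \<and> a \<rightarrow> c \<and> b \<rightarrow> c \<and> p \<rightarrow> d \<and> q \<rightarrow> d"
      using contains_J11_iff[THEN iffD1, OF J] by (elim exE)
    have nbds: "N a = {a, s, p}" "N b = {b, s, q}"
      by (rule N_eqI; use copy in auto)+
    show ?thesis
      by (rule not_admits_if_exchangeable[of a b c d s a p b q])
        (use copy in \<open>auto simp: nbds in_N_iff adj_in_verts insert_commute\<close>)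
  qed
  moreover
  have "\<not> admits_identifying_code G 3" if J: "contains_copy G J12"
  proof -
    obtain s p q a b c d where copy:
      "distinct [s, p, q, a, b, c, d] \<and>
        s \<rightarrow> a \<and> p \<rightarrow> a \<and> s \<rightarrow> b \<and> q \<rightarrow> b \<and> a \<rightarrow> c \<and> q \<rightarrow> c \<and> b \<rightarrow> d \<and> p \<rightarrow> d"
      using contains_J12_iff[THEN iffD1, OF J] by (elim exE)
    have nbds: "N a = {a, s, p}" "N b = {b, s, q}"
      by (rule N_eqI; use copy in auto)+
    show ?thesis
      by (rule not_admits_if_exchangeable[of a b c d s a p q b])
        (use copy in \<open>auto simp: nbds in_N_iff adj_in_verts insert_commute\<close>)
  qed
  moreover
  have "\<not> admits_identifying_code G 3" if J: "contains_copy G J13"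
  proof -
    obtain c1 c2 c3 c4 c5 c6 v1 v2 v3 where copy:
      "distinct [c1, c2, c3, c4, c5, c6, v1, v2, v3] \<and>
        c1 \<rightarrow> c2 \<and> c2 \<rightarrow> c3 \<and> c3 \<rightarrow> c4 \<and> c4 \<rightarrow> c5 \<and> c5 \<rightarrow> c6 \<and> c6 \<rightarrow> c1 \<and> v1 \<rightarrow> c1 \<and> v1 \<rightarrow> c4 \<and>
        v2 \<rightarrow> c2 \<and> v2 \<rightarrow> c5 \<and> v3 \<rightarrow> c3 \<and> v3 \<rightarrow> c6"
      using contains_J13_iff[THEN iffD1, OF J] by (elim exE)
    have nbds:
      "N c1 = {c1, c6, v1}" "N c2 = {c2, c1, v2}" "N c3 = {c3, c2, v3}"
      "N c4 = {c4, c3, v1}" "N c5 = {c5, c4, v2}" "N c6 = {c6, c5, v3}"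
      by (rule N_eqI; use copy in auto)+
    have "N c1 \<union> N c3 \<union> N c5 = N c2 \<union> N c4 \<union> N c6"
      unfolding nbds by (rule equalityI; simp)
    then show ?thesis
      by (rule not_admits_if_triples[of c1 c3 c5 c2 c4 c6, rotated -1])
        (use copy in \<open>auto simp: adj_in_verts\<close>)
  qed
  moreover
  have "\<not> admits_identifying_code G 3" if J: "contains_copy G J14"
  proof -
    obtain c1 c2 c3 c4 e1 e2 e3 e4 f where copy:
      "distinct [c1, c2, c3, c4, e1, e2, e3, e4, f] \<and>
        c1 \<rightarrow> c2 \<and> c2 \<rightarrow> c3 \<and> c3 \<rightarrow> c4 \<and> c4 \<rightarrow> c1 \<and> e1 \<rightarrow> c1 \<and> e2 \<rightarrow> c2 \<and> e3 \<rightarrow> c3 \<and> e4 \<rightarrow> c4 \<and>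
        e3 \<rightarrow> e1 \<and> f \<rightarrow> e1 \<and> e2 \<rightarrow> f \<and> e4 \<rightarrow> f"
      using contains_J14_iff[THEN iffD1, OF J] by (elim exE)
    have nbds:
      "N c1 = {c1, c4, e1}" "N c2 = {c2, c1, e2}" "N c3 = {c3, c2, e3}"
      "N c4 = {c4, c3, e4}" "N e1 = {e1, e3, f}" "N f = {f, e2, e4}"
      by (rule N_eqI; use copy in auto)+
    have "N c1 \<union> N c3 \<union> N f = N c2 \<union> N c4 \<union> N e1"
      unfolding nbds by (rule equalityI; simp)
    then show ?thesis
      by (rule not_admits_if_triples[of c1 c3 f c2 c4 e1, rotated -1])
        (use copy in \<open>auto simp: adj_in_verts\<close>)
  qed
  moreover
  have "\<not> admits_identifying_code G 3" if J: "contains_copy G J15"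
  proof -
    obtain c1 c2 c3 c4 e1 e2 e3 e4 f where copy:
      "distinct [c1, c2, c3, c4, e1, e2, e3, e4, f] \<and>
        c1 \<rightarrow> c2 \<and> c2 \<rightarrow> c3 \<and> c3 \<rightarrow> c4 \<and> c4 \<rightarrow> c1 \<and> e1 \<rightarrow> c1 \<and> e2 \<rightarrow> c2 \<and> e3 \<rightarrow> c3 \<and> e4 \<rightarrow> c4 \<and>
        e3 \<rightarrow> e1 \<and> f \<rightarrow> e1 \<and> e4 \<rightarrow> e2 \<and> f \<rightarrow> e2"
      using contains_J15_iff[THEN iffD1, OF J] by (elim exE)
    have nbds:
      "N c1 = {c1, c4, e1}" "N c2 = {c2, c1, e2}" "N c3 = {c3, c2, e3}"
      "N c4 = {c4, c3, e4}" "N e1 = {e1, e3, f}" "N e2 = {e2, e4, f}"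
      by (rule N_eqI; use copy in auto)+
    have "N c1 \<union> N c3 \<union> N e2 = N c2 \<union> N c4 \<union> N e1"
      unfolding nbds by (rule equalityI; simp)
    then show ?thesis
      by (rule not_admits_if_triples[of c1 c3 e2 c2 c4 e1, rotated -1])
        (use copy in \<open>auto simp: adj_in_verts\<close>)
  qed
  ultimately show ?thesis
    using assms by (auto simp: forbidden_digraphs_def)
qed

end

section \<open>Two sets with the same closed in-neighbourhood\<close>

locale forbidden_free_digraph = two_in_regular_digraph +
  assumes no_digon: "u \<rightarrow> v \<Longrightarrow> \<not> v \<rightarrow> u"
    and no_TT3_copy: "\<not> contains_copy G TT3"
    and no_forbidden_copy: "J \<in> forbidden_digraphs \<Longrightarrow> \<not> contains_copy G J"
begin

lemma no_J1:
  "\<lbrakk>distinct [p, q, a, b, c];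
    p \<rightarrow> a; q \<rightarrow> a; p \<rightarrow> b; q \<rightarrow> b; a \<rightarrow> c\<rbrakk> \<Longrightarrow> False"
  by (rule notE[OF no_forbidden_copy[of J1]], simp add: forbidden_digraphs_def,
      unfold contains_J1_iff, intro exI conjI)

lemma no_J2:
  "\<lbrakk>distinct [p, q, r, a, b];
    p \<rightarrow> a; q \<rightarrow> a; a \<rightarrow> b; r \<rightarrow> b; b \<rightarrow> p; q \<rightarrow> r\<rbrakk> \<Longrightarrow> False"
  by (rule notE[OF no_forbidden_copy[of J2]], simp add: forbidden_digraphs_def,
      unfold contains_J2_iff, intro exI conjI)

lemma no_J3:
  "\<lbrakk>distinct [p, q, r, a, b];
    p \<rightarrow> a; q \<rightarrow> a; a \<rightarrow> b; r \<rightarrow> b; b \<rightarrow> p; r \<rightarrow> q\<rbrakk> \<Longrightarrow> False"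
  by (rule notE[OF no_forbidden_copy[of J3]], simp add: forbidden_digraphs_def,
      unfold contains_J3_iff, intro exI conjI)

lemma no_J4:
  "\<lbrakk>distinct [s, p, q, a, b];
    s \<rightarrow> a; p \<rightarrow> a; s \<rightarrow> b; q \<rightarrow> b; a \<rightarrow> q; b \<rightarrow> p\<rbrakk> \<Longrightarrow> False"
  by (rule notE[OF no_forbidden_copy[of J4]], simp add: forbidden_digraphs_def,
      unfold contains_J4_iff, intro exI conjI)

lemma no_J5:
  "\<lbrakk>distinct [s, p, q, a, b, d];
    s \<rightarrow> a; p \<rightarrow> a; s \<rightarrow> b; q \<rightarrow> b; a \<rightarrow> q; b \<rightarrow> d; p \<rightarrow> d\<rbrakk> \<Longrightarrow> False"
  by (rule notE[OF no_forbidden_copy[of J5]], simp add: forbidden_digraphs_def,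
      unfold contains_J5_iff, intro exI conjI)

lemma no_J6:
  "\<lbrakk>distinct [s, p, q, a, b, c];
    s \<rightarrow> a; p \<rightarrow> a; s \<rightarrow> b; q \<rightarrow> b; a \<rightarrow> c; b \<rightarrow> c; p \<rightarrow> q\<rbrakk> \<Longrightarrow> False"
  by (rule notE[OF no_forbidden_copy[of J6]], simp add: forbidden_digraphs_def,
      unfold contains_J6_iff, intro exI conjI)

lemma no_J7:
  "\<lbrakk>distinct [p, q, r, a, b, c];
    p \<rightarrow> a; q \<rightarrow> a; a \<rightarrow> b; r \<rightarrow> b; b \<rightarrow> c; p \<rightarrow> c; r \<rightarrow> q\<rbrakk> \<Longrightarrow> False"
  by (rule notE[OF no_forbidden_copy[of J7]], simp add: forbidden_digraphs_def,
      unfold contains_J7_iff, intro exI conjI)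

lemma no_J8:
  "\<lbrakk>distinct [p, q, r, a, b, c];
    p \<rightarrow> a; q \<rightarrow> a; a \<rightarrow> b; r \<rightarrow> b; b \<rightarrow> c; p \<rightarrow> c; q \<rightarrow> r\<rbrakk> \<Longrightarrow> False"
  by (rule notE[OF no_forbidden_copy[of J8]], simp add: forbidden_digraphs_def,
      unfold contains_J8_iff, intro exI conjI)

lemma no_J9:
  "\<lbrakk>distinct [p, q, r, a, b, d];
    p \<rightarrow> a; q \<rightarrow> a; a \<rightarrow> b; r \<rightarrow> b; b \<rightarrow> p; q \<rightarrow> d; r \<rightarrow> d\<rbrakk> \<Longrightarrow> False"
  by (rule notE[OF no_forbidden_copy[of J9]], simp add: forbidden_digraphs_def,
      unfold contains_J9_iff, intro exI conjI)

lemma no_J10: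
  "\<lbrakk>distinct [p, q, r, a, b, c, d];
    p \<rightarrow> a; q \<rightarrow> a; a \<rightarrow> b; r \<rightarrow> b; b \<rightarrow> c; p \<rightarrow> c; q \<rightarrow> d; r \<rightarrow> d\<rbrakk> \<Longrightarrow> False"
  by (rule notE[OF no_forbidden_copy[of J10]], simp add: forbidden_digraphs_def,
      unfold contains_J10_iff, intro exI conjI)

lemma no_J11:
  "\<lbrakk>distinct [s, p, q, a, b, c, d];
    s \<rightarrow> a; p \<rightarrow> a; s \<rightarrow> b; q \<rightarrow> b; a \<rightarrow> c; b \<rightarrow> c; p \<rightarrow> d; q \<rightarrow> d\<rbrakk> \<Longrightarrow> False"
  by (rule notE[OF no_forbidden_copy[of J11]], simp add: forbidden_digraphs_def,
      unfold contains_J11_iff, intro exI conjI)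

lemma no_J12:
  "\<lbrakk>distinct [s, p, q, a, b, c, d];
    s \<rightarrow> a; p \<rightarrow> a; s \<rightarrow> b; q \<rightarrow> b; a \<rightarrow> c; q \<rightarrow> c; b \<rightarrow> d; p \<rightarrow> d\<rbrakk> \<Longrightarrow> False"
  by (rule notE[OF no_forbidden_copy[of J12]], simp add: forbidden_digraphs_def,
      unfold contains_J12_iff, intro exI conjI)

lemma no_J13:
  "\<lbrakk>distinct [c1, c2, c3, c4, c5, c6, v1, v2, v3];
    c1 \<rightarrow> c2; c2 \<rightarrow> c3; c3 \<rightarrow> c4; c4 \<rightarrow> c5; c5 \<rightarrow> c6; c6 \<rightarrow> c1; v1 \<rightarrow> c1; v1 \<rightarrow> c4; v2 \<rightarrow> c2;
    v2 \<rightarrow> c5; v3 \<rightarrow> c3; v3 \<rightarrow> c6\<rbrakk> \<Longrightarrow> False"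
  by (rule notE[OF no_forbidden_copy[of J13]], simp add: forbidden_digraphs_def,
      unfold contains_J13_iff, intro exI conjI)

lemma no_J14:
  "\<lbrakk>distinct [c1, c2, c3, c4, e1, e2, e3, e4, f];
    c1 \<rightarrow> c2; c2 \<rightarrow> c3; c3 \<rightarrow> c4; c4 \<rightarrow> c1; e1 \<rightarrow> c1; e2 \<rightarrow> c2; e3 \<rightarrow> c3; e4 \<rightarrow> c4; e3 \<rightarrow> e1; f \<rightarrow> e1;
    e2 \<rightarrow> f; e4 \<rightarrow> f\<rbrakk> \<Longrightarrow> False"
  by (rule notE[OF no_forbidden_copy[of J14]], simp add: forbidden_digraphs_def,
      unfold contains_J14_iff, intro exI conjI)

lemma no_J15:
  "\<lbrakk>distinct [c1, c2, c3, c4, e1, e2, e3, e4, f];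
    c1 \<rightarrow> c2; c2 \<rightarrow> c3; c3 \<rightarrow> c4; c4 \<rightarrow> c1; e1 \<rightarrow> c1; e2 \<rightarrow> c2; e3 \<rightarrow> c3; e4 \<rightarrow> c4; e3 \<rightarrow> e1; f \<rightarrow> e1;
    e4 \<rightarrow> e2; f \<rightarrow> e2\<rbrakk> \<Longrightarrow> False"
  by (rule notE[OF no_forbidden_copy[of J15]], simp add: forbidden_digraphs_def,
      unfold contains_J15_iff, intro exI conjI)

lemma no_TT3:
  assumes "a \<rightarrow> b" "b \<rightarrow> c"
  shows "\<not> a \<rightarrow> c"
  using no_TT3_copy[unfolded contains_TT3_iff] assms no_digon adj_not_same
  by (metis distinct_length_2_or_more distinct_singleton)

text \<open>
  If \<open>x\<close> and \<open>y\<close> are adjacent, the tail of the arc between them is the only common vertex, as any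
  other one would create a digon or a transitive triangle. Otherwise the common vertices
  are common in-neighbours; two of them form \<open>J1\<close> together with the arc from \<open>x\<close> to \<open>t\<close>.
\<close>
lemma common_nbr_unique:
  assumes "x \<rightarrow> t" "x \<noteq> y" and u: "u \<in> N x" "u \<in> N y" and v: "v \<in> N x" "v \<in> N y"
  shows "u = v"
proof (cases "y \<rightarrow> x \<or> x \<rightarrow> y")
  case True
  then show ?thesis
    using u v no_digon no_TT3 unfolding in_N_iff by metis
next
  case False
  with u v assms(2) have uv: "u \<rightarrow> x" "u \<rightarrow> y" "v \<rightarrow> x" "v \<rightarrow> y"
    unfolding in_N_iff by auto
  show ?thesis
  proof (rule ccontr)
    assume "u \<noteq> v"
    moreover have "t \<noteq> u" "t \<noteq> v" "t \<noteq> y"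
      using False assms(1) no_digon uv by blast+
    moreover have "u \<noteq> x" "u \<noteq> y" "v \<noteq> x" "v \<noteq> y" "t \<noteq> x"
      using uv assms(1) adj_not_same by blast+
    ultimately show False
      using no_J1[of u v x y t] uv assms(1,2) by simp
  qed
qed

text \<open>
  Covering is a bijection between \<open>Y\<close> and \<open>N x\<close>. If this holds for all \<open>x \<in> X - Y\<close> and, with the
  roles of \<open>X\<close> and \<open>Y\<close> exchanged, for all \<open>y \<in> Y - X\<close>, then the intersections \<open>N x \<inter> N y\<close> form
  a square grid of single vertices.
\<close>
definition splits :: "'a set \<Rightarrow> 'a \<Rightarrow> bool" where
  "splits Y x \<longleftrightarrow> (\<forall>y\<in>Y. \<exists>u. N x \<inter> N y = {u}) \<and> (\<forall>v\<in>N x. \<exists>!y. y \<in> Y \<and> v \<in> N y)"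

text \<open>
  A function \<open>h\<close> that selects a covering member of \<open>Y\<close> for each of the three vertices of \<open>N x\<close> is
  injective by \<open>common_nbr_unique\<close>, hence a bijection onto \<open>Y\<close>, and it is the only possible
  choice.
\<close>
lemma covered_imp_splits:
  assumes "x \<in> verts G" "x \<notin> Y" "finite Y" "card Y \<le> 3" "N x \<subseteq> \<Union>(N ` Y)"
  shows "splits Y x" and "card Y = 3"
proof -
  have "x \<in> N x"
    by (simp add: in_N_iff)
  then obtain t where "t \<in> Y" "x \<in> N t"
    using assms(5) by blast
  then have "x \<rightarrow> t"
    using assms(2) by (auto simp: in_N_iff)
  note unique = common_nbr_unique[OF this]
  obtain h where h: "\<And>v. v \<in> N x \<Longrightarrow> h v \<in> Y \<and> v \<in> N (h v)"
    using assms(5) by (metis UN_E subsetD)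
  have inj: "inj_on h (N x)"
    using h unique assms(2) by (metis inj_onI)
  have image: "h ` N x \<subseteq> Y"
    using h by blast
  have card: "card (h ` N x) = 3"
    using card_image[OF inj] card_N[OF assms(1)] by simp
  then have onto: "h ` N x = Y"
    using card_seteq[OF assms(3) image] assms(4) by simp
  with card show "card Y = 3"
    by simp
  have eq_h: "y = h v" if vy: "v \<in> N x" "y \<in> Y" "v \<in> N y" for v y
  proof -
    obtain v' where "v' \<in> N x" "y = h v'"
      using onto vy(2) by blast
    then show ?thesis
      using unique[of y v v'] h vy assms(2) by metis
  qed
  show "splits Y x"
    unfolding splits_def
  proof (intro conjI ballI)
    fix y assume "y \<in> Y"
    obtain v where "v \<in> N x" "y = h v"
      using onto \<open>y \<in> Y\<close> by blast
    moreover have "x \<noteq> y"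
      using \<open>y \<in> Y\<close> assms(2) by blast
    ultimately have "N x \<inter> N y = {v}"
      using h unique[of y v] by auto
    then show "\<exists>u. N x \<inter> N y = {u}" ..
  next
    fix v assume "v \<in> N x"
    then show "\<exists>!y. y \<in> Y \<and> v \<in> N y"
      using h eq_h by (intro ex1I[of _ "h v"]) auto
  qed
qed

lemma splits_common:
  assumes "splits Y x" "y \<in> Y"
  obtains u where "N x \<inter> N y = {u}"
  using assms unfolding splits_def by (metis (no_types))

lemma splits_cover:
  assumes "splits Y x" "v \<in> N x"
  obtains y where "y \<in> Y" "v \<in> N y"
  using assms unfolding splits_def by (metis (no_types))

lemma splits_cover_unique:
  assumes "splits Y x" "v \<in> N x" "y \<in> Y" "v \<in> N y" "y' \<in> Y" "v \<in> N y'"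
  shows "y = y'"
  using assms unfolding splits_def by (metis (no_types))

lemma splitsE:
  assumes "splits {y1, y2, y3} x" "distinct [y1, y2, y3]"
  obtains u1 u2 u3 where "N x = {u1, u2, u3}" "distinct [u1, u2, u3]"
    and "N x \<inter> N y1 = {u1}" "N x \<inter> N y2 = {u2}" "N x \<inter> N y3 = {u3}"
proof -
  obtain u1 where u1: "N x \<inter> N y1 = {u1}"
    using splits_common[OF assms(1), of y1] by auto
  obtain u2 where u2: "N x \<inter> N y2 = {u2}"
    using splits_common[OF assms(1), of y2] by auto
  obtain u3 where u3: "N x \<inter> N y3 = {u3}"
    using splits_common[OF assms(1), of y3] by auto
  have "v \<in> {u1, u2, u3}" if "v \<in> N x" for v
    using splits_cover[OF assms(1) that] u1 u2 u3 that by blast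
  moreover have in_N: "u1 \<in> N x" "u1 \<in> N y1" "u2 \<in> N x" "u2 \<in> N y2" "u3 \<in> N x" "u3 \<in> N y3"
    using u1 u2 u3 by blast+
  ultimately have "N x = {u1, u2, u3}"
    by blast
  moreover have "u1 \<noteq> u2" "u1 \<noteq> u3" "u2 \<noteq> u3"
    using splits_cover_unique[OF assms(1) in_N(1), of y1 y2]
      splits_cover_unique[OF assms(1) in_N(1), of y1 y3]
      splits_cover_unique[OF assms(1) in_N(3), of y2 y3] in_N assms(2) by auto
  ultimately show thesis
    using that u1 u2 u3 by simp
qed

text \<open>
  A common vertex of \<open>N x\<close> and \<open>N x'\<close> would be covered by some \<open>y \<in> Y\<close>, and \<open>x\<close> and \<open>x'\<close> would
  both cover this vertex of \<open>N y\<close>.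
\<close>
lemma splits_disjoint:
  assumes "splits Y x" "\<And>y. y \<in> Y \<Longrightarrow> splits X y" "x \<in> X" "x' \<in> X" "x \<noteq> x'"
  shows "N x \<inter> N x' = {}"
proof (rule ccontr)
  assume "N x \<inter> N x' \<noteq> {}"
  then obtain v where v: "v \<in> N x" "v \<in> N x'"
    by blast
  obtain y where "y \<in> Y" "v \<in> N y"
    using splits_cover[OF assms(1) v(1)] .
  then show False
    using splits_cover_unique[OF assms(2), of y v x x'] assms(3-5) v by simp
qed

section \<open>Exchanging one or two vertices\<close>

lemma in_N_neq: "v \<in> N u \<Longrightarrow> v \<noteq> u \<Longrightarrow> v \<rightarrow> u"
  by (simp add: in_N_iff)

text \<open>
  Two distinct vertices of one closed in-neighbourhood are adjacent or have a common out-neighbour.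
  The forbidden digraphs \<open>J2\<close> to \<open>J12\<close> arise by making this choice twice.
\<close>
lemma common_cover_cases:
  assumes "u \<in> N w" "v \<in> N w" "u \<noteq> v"
  obtains "w = u" "v \<rightarrow> u" | "w = v" "u \<rightarrow> v" | "u \<rightarrow> w" "v \<rightarrow> w" "w \<noteq> u" "w \<noteq> v"
  using assms adj_not_same unfolding in_N_iff by metis

text \<open>
  The shared vertex of \<open>N a\<close> and \<open>N b\<close> is \<open>a\<close> itself. The two ways to have \<open>p\<close> and \<open>b\<close> in \<open>N z\<close> combine
  with the three ways to have \<open>q\<close> and \<open>r\<close> in \<open>N w\<close> to \<open>J2\<close>, \<open>J3\<close>, \<open>J7\<close>, \<open>J8\<close>, \<open>J9\<close> and \<open>J10\<close>.
\<close>
lemma no_exchange_along_arc: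
  assumes "N a = {a, p, q}" "N b = {a, b, r}" "distinct [a, b, p, q, r]"
    and "p \<in> N z" "b \<in> N z" "q \<in> N w" "r \<in> N w"
    and "z \<notin> {a, b}" "w \<notin> {a, b}" "z \<noteq> w"
  shows False
proof -
  have arcs: "p \<rightarrow> a" "q \<rightarrow> a" "a \<rightarrow> b" "r \<rightarrow> b"
    using assms(1-3) by (auto intro!: in_N_neq)
  have b: "b \<rightarrow> z"
    using in_N_neq[OF assms(5)] assms(8) by auto
  have d: "p \<noteq> q" "p \<noteq> b" "q \<noteq> r"
    using assms(3) by auto
  (* The remaining vertices of the forbidden digraph do not coincide: otherwise a digon or a
     transitive triangle would appear. *)
  have far: "z \<noteq> q" "z \<noteq> r"
    using b no_TT3[of q a b] no_TT3[of p q a] arcs no_digon[of q a] in_N_neq[OF assms(4)] d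
      no_digon[of r b] by auto
  have far': "w \<noteq> p"
    using in_N_neq[OF assms(6)] no_TT3[of q p a] arcs d by auto
  note distinct = assms(3,8-10) far far'
  show False
  proof (rule common_cover_cases[OF assms(4,5) d(2)])
    assume "z = p" "b \<rightarrow> p"
    show False
    proof (rule common_cover_cases[OF assms(6,7) d(3)])
      assume "w = q" "r \<rightarrow> q"
      then show False
        using no_J3[of p q r a b] distinct arcs \<open>b \<rightarrow> p\<close> by auto
    next
      assume "w = r" "q \<rightarrow> r"
      then show False
        using no_J2[of p q r a b] distinct arcs \<open>b \<rightarrow> p\<close> by auto
    next
      assume "q \<rightarrow> w" "r \<rightarrow> w" "w \<noteq> q" "w \<noteq> r"
      then show False
        using no_J9[of p q r a b w] distinct arcs \<open>b \<rightarrow> p\<close> by auto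
    qed
  next
    assume "z = b"
    then show False
      using assms(8) by simp
  next
    assume z: "p \<rightarrow> z" "b \<rightarrow> z" "z \<noteq> p" "z \<noteq> b"
    show False
    proof (rule common_cover_cases[OF assms(6,7) d(3)])
      assume "w = q" "r \<rightarrow> q"
      then show False
        using no_J7[of p q r a b z] distinct arcs z by auto
    next
      assume "w = r" "q \<rightarrow> r"
      then show False
        using no_J8[of p q r a b z] distinct arcs z by auto
    next
      assume "q \<rightarrow> w" "r \<rightarrow> w" "w \<noteq> q" "w \<noteq> r"
      then show False
        using no_J10[of p q r a b z w] distinct arcs z by auto
    qed
  qed
qed

text \<open>
  The shared vertex is a common in-neighbour \<open>s\<close>, and \<open>a\<close> is matched with \<open>b\<close>. This gives \<open>J6\<close> if \<open>p\<close>
  and \<open>q\<close> are adjacent, and \<open>J11\<close> otherwise.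
\<close>
lemma no_exchange_same:
  assumes "N a = {a, s, p}" "N b = {b, s, q}" "distinct [a, b, s, p, q]"
    and "a \<in> N z" "b \<in> N z" "p \<in> N w" "q \<in> N w"
    and "z \<notin> {a, b}" "w \<notin> {a, b}" "z \<noteq> w"
  shows False
proof -
  have arcs: "s \<rightarrow> a" "p \<rightarrow> a" "s \<rightarrow> b" "q \<rightarrow> b"
    using assms(1-3) by (auto intro!: in_N_neq)
  have z: "a \<rightarrow> z" "b \<rightarrow> z"
    using in_N_neq[OF assms(4)] in_N_neq[OF assms(5)] assms(8) by auto
  have far: "z \<noteq> s" "z \<noteq> p" "z \<noteq> q"
    using z arcs no_digon by blast+
  have "p \<noteq> s" "p \<noteq> q"
    using assms(3) by auto
  then have far': "w \<noteq> s"
    using in_N_neq[OF assms(6)] no_TT3[of p s a] arcs by auto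
  note distinct = assms(3,8-10) far far'
  show False
  proof (rule common_cover_cases[OF assms(6,7) \<open>p \<noteq> q\<close>])
    assume "w = p" "q \<rightarrow> p"
    then show False
      using no_J6[of s q p b a z] distinct arcs z by auto
  next
    assume "w = q" "p \<rightarrow> q"
    then show False
      using no_J6[of s p q a b z] distinct arcs z by auto
  next
    assume "p \<rightarrow> w" "q \<rightarrow> w" "w \<noteq> p" "w \<noteq> q"
    then show False
      using no_J11[of s p q a b z w] distinct arcs z by auto
  qed
qed

text \<open>
  The shared vertex is a common in-neighbour \<open>s\<close>, and \<open>a\<close> and \<open>b\<close> are matched with the second
  in-neighbours of each other. This gives \<open>J4\<close>, \<open>J5\<close> (in two symmetric ways) or \<open>J12\<close>.
\<close>
lemma no_exchange_crossed:
  assumes "N a = {a, s, p}" "N b = {b, s, q}" "distinct [a, b, s, p, q]"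
    and "a \<in> N z" "q \<in> N z" "b \<in> N w" "p \<in> N w"
    and "z \<notin> {a, b}" "w \<notin> {a, b}" "z \<noteq> w"
  shows False
proof -
  have arcs: "s \<rightarrow> a" "p \<rightarrow> a" "s \<rightarrow> b" "q \<rightarrow> b"
    using assms(1-3) by (auto intro!: in_N_neq)
  have zw: "a \<rightarrow> z" "b \<rightarrow> w"
    using in_N_neq[OF assms(4)] in_N_neq[OF assms(6)] assms(8,9) by auto
  have far: "z \<noteq> s" "z \<noteq> p" "w \<noteq> s" "w \<noteq> q"
    using zw arcs no_digon by blast+
  note distinct = assms(3,8-10) far
  consider "z = q" "w = p" | "z = q" "p \<rightarrow> w" "w \<noteq> p" | "q \<rightarrow> z" "z \<noteq> q" "w = p"
    | "q \<rightarrow> z" "z \<noteq> q" "p \<rightarrow> w" "w \<noteq> p"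
    using in_N_neq[OF assms(5)] in_N_neq[OF assms(7)] by auto
  then show False
  proof cases
    case 1
    then show False
      using no_J4[of s p q a b] distinct arcs zw by auto
  next
    case 2
    then show False
      using no_J5[of s p q a b w] distinct arcs zw by auto
  next
    case 3
    then show False
      using no_J5[of s q p b a z] distinct arcs zw by auto
  next
    case 4
    then show False
      using no_J12[of s p q a b z w] distinct arcs zw by auto
  qed
qed

text \<open>
  The three lemmas above distinguish where \<open>a\<close> and \<open>b\<close> themselves occur in the
  matching; the other positions follow by swapping \<open>a\<close> with \<open>b\<close> or \<open>z\<close> with \<open>w\<close>.
\<close>
lemma no_exchange:
  assumes "N a = {s, p, q}" "N b = {s, p', q'}" "distinct [s, p, q, p', q']"
    and "p \<in> N z" "p' \<in> N z" "q \<in> N w" "q' \<in> N w"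
    and "a \<noteq> b" "z \<notin> {a, b}" "w \<notin> {a, b}" "z \<noteq> w"
  shows False
proof -
  have "a \<in> {s, p, q}" "b \<in> {s, p', q'}"
    using assms(1,2) in_N_iff by blast+
  then consider "a = s" "b = p'" | "a = s" "b = q'" | "b = s" "a = p" | "b = s" "a = q"
    | "a = p" "b = p'" | "a = q" "b = q'" | "a = p" "b = q'" | "a = q" "b = p'"
    using assms(8) by auto
  then show False
  proof cases
    case 1
    then show False
      using assms no_exchange_along_arc[of a p q b q' z w] by (auto simp: insert_commute)
  next
    case 2
    then show False
      using assms no_exchange_along_arc[of a q p b p' w z] by (auto simp: insert_commute)
  next
    case 3
    then show False
      using assms no_exchange_along_arc[of b p' q' a q z w] by (auto simp: insert_commute)
  next
    case 4
    then show False
      using assms no_exchange_along_arc[of b q' p' a p w z] by (auto simp: insert_commute)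
  next
    case 5
    then show False
      using assms no_exchange_same[of a s q b q' z w] by (auto simp: insert_commute)
  next
    case 6
    then show False
      using assms no_exchange_same[of a s p b p' w z] by (auto simp: insert_commute)
  next
    case 7
    then show False
      using assms no_exchange_crossed[of a s q b p' z w] by (auto simp: insert_commute)
  next
    case 8
    then show False
      using assms no_exchange_crossed[of a s p b q' w z] by (auto simp: insert_commute)
  qed
qed

text \<open>
  The single vertex of \<open>N x \<inter> N y\<close> is the shared one, and \<open>z\<close> and \<open>w\<close> match the others.
\<close>
lemma no_single_swap:
  assumes x: "splits {y, z, w} x" and y: "splits {x, z, w} y" and "distinct [x, y, z, w]"
  shows False
proof -
  have d: "distinct [y, z, w]" "distinct [x, z, w]"
    using assms(3) by auto
  obtain s p q where Nx: "N x = {s, p, q}" "distinct [s, p, q]"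
    "N x \<inter> N y = {s}" "N x \<inter> N z = {p}" "N x \<inter> N w = {q}"
    by (rule splitsE[OF x d(1)])
  obtain s' p' q' where Ny: "N y = {s', p', q'}" "distinct [s', p', q']"
    "N y \<inter> N x = {s'}" "N y \<inter> N z = {p'}" "N y \<inter> N w = {q'}"
    by (rule splitsE[OF y d(2)])
  have s: "s' = s"
    using Nx(3) Ny(3) by (metis Int_commute singleton_inject)
  have "{p', q'} \<inter> N x = {}"
    using Ny(1-3) by auto
  then have "distinct [s, p, q, p', q']"
    using Nx(1,2) Ny(2) s by auto
  moreover have "p \<in> N z" "p' \<in> N z" "q \<in> N w" "q' \<in> N w"
    using Nx(4,5) Ny(4,5) by blast+
  moreover have "x \<noteq> y" "z \<notin> {x, y}" "w \<notin> {x, y}" "z \<noteq> w"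
    using assms(3) by auto
  ultimately show False
    using no_exchange[OF Nx(1) Ny(1)[unfolded s]] by blast
qed

text \<open>
  Here \<open>mij\<close> is the vertex of \<open>N xi \<inter> N yj\<close>, while \<open>\<alpha>i\<close> and \<open>\<beta>j\<close> are the vertices of \<open>N xi\<close> and \<open>N yj\<close>
  in \<open>N z\<close>. No \<open>\<alpha>i\<close> equals a \<open>\<beta>j\<close>, because \<open>N xi\<close> and \<open>N yj\<close> have only \<open>mij\<close> in common. As
  \<open>N z\<close> has three elements, \<open>\<alpha>1 = \<alpha>2\<close> or \<open>\<beta>1 = \<beta>2\<close>. In the first case \<open>x1\<close> and \<open>x2\<close> can
  be exchanged through \<open>y1\<close> and \<open>y2\<close>, in the second one \<open>y1\<close> and \<open>y2\<close> through \<open>x1\<close> and \<open>x2\<close>.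
\<close>
lemma no_double_swap:
  assumes x: "splits {y1, y2, z} x1" "splits {y1, y2, z} x2"
    and y: "splits {x1, x2, z} y1" "splits {x1, x2, z} y2"
    and "distinct [x1, x2, y1, y2, z]" "card (N z) = 3"
  shows False
proof -
  have d: "distinct [y1, y2, z]" "distinct [x1, x2, z]"
    using assms(5) by auto
  obtain m11 m12 \<alpha>1 where x1: "N x1 = {m11, m12, \<alpha>1}" "distinct [m11, m12, \<alpha>1]"
    "N x1 \<inter> N y1 = {m11}" "N x1 \<inter> N y2 = {m12}" "N x1 \<inter> N z = {\<alpha>1}"
    by (rule splitsE[OF x(1) d(1)])
  obtain m21 m22 \<alpha>2 where x2: "N x2 = {m21, m22, \<alpha>2}" "distinct [m21, m22, \<alpha>2]"
    "N x2 \<inter> N y1 = {m21}" "N x2 \<inter> N y2 = {m22}" "N x2 \<inter> N z = {\<alpha>2}"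
    by (rule splitsE[OF x(2) d(1)])
  obtain n11 n21 \<beta>1 where y1: "N y1 = {n11, n21, \<beta>1}" "distinct [n11, n21, \<beta>1]"
    "N y1 \<inter> N x1 = {n11}" "N y1 \<inter> N x2 = {n21}" "N y1 \<inter> N z = {\<beta>1}"
    by (rule splitsE[OF y(1) d(2)])
  obtain n12 n22 \<beta>2 where y2: "N y2 = {n12, n22, \<beta>2}" "distinct [n12, n22, \<beta>2]"
    "N y2 \<inter> N x1 = {n12}" "N y2 \<inter> N x2 = {n22}" "N y2 \<inter> N z = {\<beta>2}"
    by (rule splitsE[OF y(2) d(2)])
  have n: "n11 = m11" "n21 = m21" "n12 = m12" "n22 = m22"
    using x1(3,4) x2(3,4) y1(3,4) y2(3,4) by (metis Int_commute singleton_inject)+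
  note y1 = y1[unfolded n] and y2 = y2[unfolded n]
  have cross: "m11 \<noteq> m22" "m12 \<noteq> m21"
    using x1(1-4) x2(1-4) y1(1,2) y2(1,2) by auto
  have "\<alpha>1 \<in> N z" "\<alpha>2 \<in> N z" "\<beta>1 \<in> N z" "\<beta>2 \<in> N z"
    using x1(5) x2(5) y1(5) y2(5) by blast+
  moreover have "\<alpha>1 \<notin> N y1 \<union> N y2" "\<alpha>2 \<notin> N y1 \<union> N y2"
    using x1(1-4) x2(1-4) by auto
  then have "{\<alpha>1, \<alpha>2} \<inter> {\<beta>1, \<beta>2} = {}"
    using y1(1) y2(1) by auto
  ultimately have "\<alpha>1 = \<alpha>2 \<or> \<beta>1 = \<beta>2"
  proof -
    assume *: "\<alpha>1 \<in> N z" "\<alpha>2 \<in> N z" "\<beta>1 \<in> N z" "\<beta>2 \<in> N z" "{\<alpha>1, \<alpha>2} \<inter> {\<beta>1, \<beta>2} = {}"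
    have "finite (N z)"
      using assms(6) card.infinite by fastforce
    then have "card {\<alpha>1, \<alpha>2, \<beta>1, \<beta>2} \<le> 3"
      using card_mono[of "N z" "{\<alpha>1, \<alpha>2, \<beta>1, \<beta>2}"] * assms(6) by simp
    then show ?thesis
      using *(5) by (auto simp: card_insert_if split: if_splits)
  qed
  then show False
  proof
    assume eq: "\<alpha>1 = \<alpha>2"
    have "distinct [\<alpha>1, m11, m12, m21, m22]"
      using x1(2) x2(2) y1(2) y2(2) cross eq by auto
    moreover have "m11 \<in> N y1" "m21 \<in> N y1" "m12 \<in> N y2" "m22 \<in> N y2"
      using y1(1) y2(1) by auto
    moreover have "N x1 = {\<alpha>1, m11, m12}" "N x2 = {\<alpha>1, m21, m22}"
      using x1(1) x2(1) eq by auto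
    ultimately show False
      using no_exchange[of x1 \<alpha>1 m11 m12 x2 m21 m22 y1 y2] assms(5) by auto
  next
    assume eq: "\<beta>1 = \<beta>2"
    have "distinct [\<beta>1, m11, m21, m12, m22]"
      using x1(2) x2(2) y1(2) y2(2) cross eq by auto
    moreover have "m11 \<in> N x1" "m21 \<in> N x2" "m12 \<in> N x1" "m22 \<in> N x2"
      using x1(1) x2(1) by auto
    moreover have "N y1 = {\<beta>1, m11, m21}" "N y2 = {\<beta>1, m12, m22}"
      using y1(1) y2(1) eq by auto
    ultimately show False
      using no_exchange[of y1 \<beta>1 m11 m21 y2 m12 m22 x1 x2] assms(5) by auto
  qed
qed

section \<open>Disjoint triples and alternating cycles\<close>

text \<open>
  Let \<open>ei\<close> be the in-neighbour of \<open>ci\<close> off the cycle. Two vertices of \<open>N c1\<close> and \<open>N c3\<close> are covered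
  by \<open>c2\<close> and \<open>c4\<close>, so \<open>y\<close> covers \<open>e1\<close> and \<open>e3\<close>; likewise \<open>x\<close> covers \<open>e2\<close> and \<open>e4\<close>. With \<open>g\<close>
  for the vertex covered by both \<open>x\<close> and \<open>y\<close>, this means \<open>N x = {e2, e4, g}\<close> and
  \<open>N y = {e1, e3, g}\<close>. What remains is the position of \<open>x\<close> and \<open>y\<close> in these sets: \<open>J14\<close> arises
  if one of them is \<open>g\<close>, and \<open>J15\<close> otherwise.
\<close>
lemma no_alternating_4_cycle:
  assumes X: "splits {c2, c4, y} c1" "splits {c2, c4, y} c3" "splits {c2, c4, y} x"
    and Y: "splits {c1, c3, x} c2" "splits {c1, c3, x} c4" "splits {c1, c3, x} y"
    and "distinct [c1, c2, c3, c4, x, y]"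
    and cycle: "c1 \<rightarrow> c2" "c2 \<rightarrow> c3" "c3 \<rightarrow> c4" "c4 \<rightarrow> c1"
  shows False
proof -
  have d: "distinct [c2, c4, y]" "distinct [c1, c3, x]"
    using assms(7) by auto
  have on_cycle: "c1 \<in> N c1 \<inter> N c2" "c2 \<in> N c2 \<inter> N c3" "c3 \<in> N c3 \<inter> N c4" "c4 \<in> N c4 \<inter> N c1"
    using cycle by (auto simp: in_N_iff)
  obtain e1 where e1: "N c1 = {c1, c4, e1}" "distinct [c1, c4, e1]" "N c1 \<inter> N y = {e1}"
    using splitsE[OF X(1) d(1)] on_cycle(1,4) by (metis Int_iff singletonD Int_commute)
  obtain e3 where e3: "N c3 = {c2, c3, e3}" "distinct [c2, c3, e3]" "N c3 \<inter> N y = {e3}"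
    using splitsE[OF X(2) d(1)] on_cycle(2,3) by (metis Int_iff singletonD Int_commute)
  obtain e2 where e2: "N c2 = {c1, c2, e2}" "distinct [c1, c2, e2]" "N c2 \<inter> N x = {e2}"
    using splitsE[OF Y(1) d(2)] on_cycle(1,2) by (metis Int_iff singletonD Int_commute)
  obtain e4 where e4: "N c4 = {c4, c3, e4}" "distinct [c4, c3, e4]" "N c4 \<inter> N x = {e4}"
    using splitsE[OF Y(2) d(2)] on_cycle(3,4) by (metis Int_iff singletonD Int_commute)
  obtain g where g: "N x = {e2, e4, g}" "distinct [e2, e4, g]" "N x \<inter> N y = {g}"
    using splitsE[OF X(3) d(1)] e2(3) e4(3) by (metis singleton_inject Int_commute)
  have Ny: "N y = {e1, e3, g}" "distinct [e1, e3, g]"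
    using splitsE[OF Y(3) d(2)] e1(3) e3(3) g(3) by (metis singleton_inject Int_commute)+
  have "N c1 \<inter> N c3 = {}" "N c1 \<inter> N x = {}" "N c3 \<inter> N x = {}"
    using splits_disjoint[of "{c2, c4, y}" _ "{c1, c3, x}"] X Y d(2) by auto
  (* The three disjoint sets contain exactly the nine vertices of the forbidden digraph. *)
  then have distinct: "distinct [c1, c2, c3, c4, e1, e2, e3, e4, g]"
    using e1(1,2) e3(1,2) g(1,2) by auto
  have spokes: "e1 \<rightarrow> c1" "e2 \<rightarrow> c2" "e3 \<rightarrow> c3" "e4 \<rightarrow> c4"
    using e1(1,2) e2(1,2) e3(1,2) e4(1,2) by (auto intro!: in_N_neq)
  have x: "v \<rightarrow> x" if "v \<in> {e2, e4, g}" "v \<noteq> x" for v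
    using that g(1) in_N_neq by blast
  have y: "v \<rightarrow> y" if "v \<in> {e1, e3, g}" "v \<noteq> y" for v
    using that Ny(1) in_N_neq by blast
  note facts = distinct cycle spokes
  have "x \<in> {e2, e4, g}" "y \<in> {e1, e3, g}" "x \<noteq> y"
    using g(1) Ny(1) assms(7) in_N_iff by auto
  (* The cases are pairwise related by rotations of the cycle; the forbidden digraph is
     instantiated accordingly. *)
  then consider "x = g" "y = e1" | "x = g" "y = e3" | "x = e2" "y = g" | "x = e4" "y = g"
    | "x = e2" "y = e1" | "x = e2" "y = e3" | "x = e4" "y = e3" | "x = e4" "y = e1"
    by blast
  then show False
  proof cases
    case 1
    then show False
      using no_J14[of c1 c2 c3 c4 e1 e2 e3 e4 g] facts x[of e2] x[of e4] y[of e3] y[of g] by auto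
  next
    case 2
    then show False
      using no_J14[of c3 c4 c1 c2 e3 e4 e1 e2 g] facts x[of e2] x[of e4] y[of e1] y[of g] by auto
  next
    case 3
    then show False
      using no_J14[of c2 c3 c4 c1 e2 e3 e4 e1 g] facts x[of e4] x[of g] y[of e1] y[of e3] by auto
  next
    case 4
    then show False
      using no_J14[of c4 c1 c2 c3 e4 e1 e2 e3 g] facts x[of e2] x[of g] y[of e1] y[of e3] by auto
  next
    case 5
    then show False
      using no_J15[of c1 c2 c3 c4 e1 e2 e3 e4 g] facts x[of e4] x[of g] y[of e3] y[of g] by auto
  next
    case 6
    then show False
      using no_J15[of c2 c3 c4 c1 e2 e3 e4 e1 g] facts x[of e4] x[of g] y[of e1] y[of g] by auto
  next
    case 7
    then show False
      using no_J15[of c3 c4 c1 c2 e3 e4 e1 e2 g] facts x[of e2] x[of g] y[of e1] y[of g] by auto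
  next
    case 8
    then show False
      using no_J15[of c4 c1 c2 c3 e4 e1 e2 e3 g] facts x[of e2] x[of g] y[of e3] y[of g] by auto
  qed
qed

text \<open>
  The two neighbours of \<open>ci\<close> on the cycle cover the two cycle vertices in \<open>N ci\<close>. So the
  in-neighbour of \<open>ci\<close> off the cycle is covered by the opposite vertex of the cycle, and
  opposite vertices share this in-neighbour.
\<close>
lemma no_alternating_6_cycle:
  assumes X: "splits {c2, c4, c6} c1" "splits {c2, c4, c6} c3" "splits {c2, c4, c6} c5"
    and Y: "splits {c1, c3, c5} c2" "splits {c1, c3, c5} c4" "splits {c1, c3, c5} c6"
    and "distinct [c1, c2, c3, c4, c5, c6]"
    and cycle: "c1 \<rightarrow> c2" "c2 \<rightarrow> c3" "c3 \<rightarrow> c4" "c4 \<rightarrow> c5" "c5 \<rightarrow> c6" "c6 \<rightarrow> c1"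
  shows False
proof -
  have d: "distinct [c2, c4, c6]" "distinct [c1, c3, c5]"
    using assms(7) by auto
  have on_cycle: "c1 \<in> N c1 \<inter> N c2" "c2 \<in> N c2 \<inter> N c3" "c3 \<in> N c3 \<inter> N c4"
    "c4 \<in> N c4 \<inter> N c5" "c5 \<in> N c5 \<inter> N c6" "c6 \<in> N c6 \<inter> N c1"
    using cycle by (auto simp: in_N_iff)
  obtain v1 where v1: "N c1 = {c1, v1, c6}" "distinct [c1, v1, c6]" "N c1 \<inter> N c4 = {v1}"
    using splitsE[OF X(1) d(1)] on_cycle(1,6) by (metis Int_iff singletonD Int_commute)
  obtain v3 where v3: "N c3 = {c2, c3, v3}" "distinct [c2, c3, v3]" "N c3 \<inter> N c6 = {v3}"
    using splitsE[OF X(2) d(1)] on_cycle(2,3) by (metis Int_iff singletonD Int_commute)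
  obtain v2 where v2: "N c5 = {v2, c4, c5}" "distinct [v2, c4, c5]" "N c5 \<inter> N c2 = {v2}"
    using splitsE[OF X(3) d(1)] on_cycle(4,5) by (metis Int_iff singletonD Int_commute)
  have "N c1 \<inter> N c3 = {}" "N c1 \<inter> N c5 = {}" "N c3 \<inter> N c5 = {}"
    using splits_disjoint[of "{c2, c4, c6}" _ "{c1, c3, c5}"] X Y d(2) by auto
  then have distinct: "distinct [c1, c2, c3, c4, c5, c6, v1, v2, v3]"
    using v1(1,2) v2(1,2) v3(1,2) by auto
  have "v1 \<in> N c1" "v1 \<in> N c4" "v2 \<in> N c5" "v2 \<in> N c2" "v3 \<in> N c3" "v3 \<in> N c6"
    using v1(3) v2(3) v3(3) by blast+
  then have "v1 \<rightarrow> c1" "v1 \<rightarrow> c4" "v2 \<rightarrow> c2" "v2 \<rightarrow> c5" "v3 \<rightarrow> c3" "v3 \<rightarrow> c6"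
    using distinct by (auto intro!: in_N_neq)
  then show False
    using no_J13[of c1 c2 c3 c4 c5 c6 v1 v2 v3] distinct cycle by simp
qed

text \<open>
  Following arcs from \<open>X\<close> to \<open>Y\<close> and back closes a cycle after at most six steps. There are no
  digons, so its length is 4 or 6.
\<close>
lemma no_disjoint_swap:
  assumes X: "\<And>x. x \<in> X \<Longrightarrow> splits Y x" and Y: "\<And>y. y \<in> Y \<Longrightarrow> splits X y"
    and "card X = 3" "card Y = 3" "X \<inter> Y = {}"
  shows False
proof -
  have third: "\<exists>w. Z = {u, v, w} \<and> w \<noteq> u \<and> w \<noteq> v"
    if Z: "card Z = 3" "u \<in> Z" "v \<in> Z" "u \<noteq> v" for Z :: "'a set" and u v
  proof -
    obtain x y z where "Z = {x, y, z}" "distinct [x, y, z]"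
      using Z(1) by (auto simp: card_3_iff)
    then show ?thesis
      using Z(2-4) by auto
  qed
  have out_X: "\<exists>y\<in>Y. x \<rightarrow> y" if x: "x \<in> X" for x
  proof -
    obtain y where "y \<in> Y" "x \<in> N y"
      using splits_cover[OF X[OF x], of x] by (auto simp: in_N_iff)
    then show ?thesis
      using x assms(5) in_N_neq[of x y] by blast
  qed
  have out_Y: "\<exists>x\<in>X. y \<rightarrow> x" if y: "y \<in> Y" for y
  proof -
    obtain x where "x \<in> X" "y \<in> N x"
      using splits_cover[OF Y[OF y], of y] by (auto simp: in_N_iff)
    then show ?thesis
      using y assms(5) in_N_neq[of y x] by blast
  qed
  have no_4_cycle: False
    if c: "c1 \<in> S" "c2 \<in> T" "c3 \<in> S" "c4 \<in> T" "c1 \<rightarrow> c2" "c2 \<rightarrow> c3" "c3 \<rightarrow> c4" "c4 \<rightarrow> c1"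
      and ST: "S = X \<and> T = Y \<or> S = Y \<and> T = X"
    for c1 c2 c3 c4 S T
  proof -
    have "c1 \<noteq> c3" "c2 \<noteq> c4"
      using c(5-8) no_digon by blast+
    moreover have "card S = 3" "card T = 3"
      using ST assms(3,4) by auto
    ultimately obtain x y where "S = {c1, c3, x}" "x \<noteq> c1" "x \<noteq> c3" "T = {c2, c4, y}" "y \<noteq> c2" "y \<noteq> c4"
      using third[of S c1 c3] third[of T c2 c4] c(1-4) by blast
    moreover have "S \<inter> T = {}" "\<forall>s\<in>S. splits T s" "\<forall>t\<in>T. splits S t"
      using ST X Y assms(5) by auto
    ultimately show False
      using no_alternating_4_cycle[of c2 c4 y c1 c3 x] c(5-8) \<open>c1 \<noteq> c3\<close> \<open>c2 \<noteq> c4\<close> by auto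
  qed
  obtain c1 where c1: "c1 \<in> X"
    using assms(3) by fastforce
  obtain c2 where c2: "c2 \<in> Y" "c1 \<rightarrow> c2"
    using out_X[OF c1] by blast
  obtain c3 where c3: "c3 \<in> X" "c2 \<rightarrow> c3"
    using out_Y[OF c2(1)] by blast
  obtain c4 where c4: "c4 \<in> Y" "c3 \<rightarrow> c4"
    using out_X[OF c3(1)] by blast
  obtain c5 where c5: "c5 \<in> X" "c4 \<rightarrow> c5"
    using out_Y[OF c4(1)] by blast
  obtain c6 where c6: "c6 \<in> Y" "c5 \<rightarrow> c6"
    using out_X[OF c5(1)] by blast
  obtain c7 where c7: "c7 \<in> X" "c6 \<rightarrow> c7"
    using out_Y[OF c6(1)] by blast
  have neq: "c1 \<noteq> c3" "c2 \<noteq> c4" "c3 \<noteq> c5" "c4 \<noteq> c6" "c5 \<noteq> c7"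
    using c2(2) c3(2) c4(2) c5(2) c6(2) c7(2) no_digon by blast+
  have "c5 \<noteq> c1"
    using no_4_cycle[of c1 X c2 Y c3 c4] c1 c2 c3 c4 c5 by blast
  then have X_eq: "X = {c1, c3, c5}"
    using third[OF assms(3) c1 c3(1)] neq c5(1) by blast
  have "c6 \<noteq> c2"
    using no_4_cycle[of c2 Y c3 X c4 c5] c2 c3 c4 c5 c6 by blast
  then have Y_eq: "Y = {c2, c4, c6}"
    using third[OF assms(4) c2(1) c4(1)] neq c6(1) by blast
  have "c7 \<noteq> c3"
    using no_4_cycle[of c3 X c4 Y c5 c6] c3 c4 c5 c6 c7 by blast
  then have "c7 = c1"
    using c7(1) neq(5) X_eq by blast
  moreover have "distinct [c1, c2, c3, c4, c5, c6]"
    using neq \<open>c5 \<noteq> c1\<close> \<open>c6 \<noteq> c2\<close> assms(5) X_eq Y_eq by auto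
  ultimately show False
    using no_alternating_6_cycle[of c2 c4 c6 c1 c3 c5] X Y c2(2) c3(2) c4(2) c5(2) c6(2) c7(2)
    unfolding X_eq Y_eq by auto
qed

section \<open>The characterization\<close>

text \<open>
  A vertex in \<open>X - Y\<close> forces \<open>card Y = 3\<close>; then \<open>Y\<close> is no proper subset of \<open>X\<close>, so there is a vertex
  in \<open>Y - X\<close> as well, and it forces \<open>card X = 3\<close>. The three cases are those of
  \<open>card (X \<inter> Y)\<close>.
\<close>
lemma closed_nbrs_separate:
  assumes XY: "X \<subseteq> verts G" "Y \<subseteq> verts G" "card X \<in> {1..3}" "card Y \<in> {1..3}"
    and eq: "\<Union>(N ` X) = \<Union>(N ` Y)"
  shows "X = Y"
proof (rule ccontr)
  assume "X \<noteq> Y"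
  have fin: "finite X" "finite Y"
    using XY(3,4) card.infinite by fastforce+
  have X: "splits Y x" "card Y = 3" if x: "x \<in> X - Y" for x
  proof -
    have "N x \<subseteq> \<Union>(N ` X)"
      using x by blast
    then have "x \<in> verts G" "x \<notin> Y" "card Y \<le> 3" "N x \<subseteq> \<Union>(N ` Y)"
      using x XY eq by auto
    then show "splits Y x" "card Y = 3"
      using covered_imp_splits[of x Y] fin by blast+
  qed
  have Y: "splits X y" "card X = 3" if y: "y \<in> Y - X" for y
  proof -
    have "N y \<subseteq> \<Union>(N ` Y)"
      using y by blast
    then have "y \<in> verts G" "y \<notin> X" "card X \<le> 3" "N y \<subseteq> \<Union>(N ` X)"
      using y XY eq by auto
    then show "splits X y" "card X = 3"
      using covered_imp_splits[of y X] fin by blast+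
  qed
  have card3: "card X = 3" "card Y = 3"
  proof -
    have "card X = 3 \<and> card Y = 3"
    proof (cases "X \<subseteq> Y")
      case True
      then obtain y where "y \<in> Y - X"
        using \<open>X \<noteq> Y\<close> by blast
      then have "card X = 3"
        by (rule Y(2))
      moreover have "card X < card Y"
        using True \<open>X \<noteq> Y\<close> fin by (simp add: psubset_card_mono psubset_eq)
      ultimately show ?thesis
        using XY(4) by auto
    next
      case False
      then obtain x where "x \<in> X - Y"
        by blast
      then have "card Y = 3"
        by (rule X(2))
      moreover have "\<not> Y \<subset> X"
        using psubset_card_mono[OF fin(1), of Y] calculation XY(3) by auto
      then obtain y where "y \<in> Y - X"
        using \<open>X \<noteq> Y\<close> by blast
      then have "card X = 3"
        by (rule Y(2))
      ultimately show ?thesis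
        by simp
    qed
    then show "card X = 3" "card Y = 3"
      by auto
  qed
  have diff: "card (X - Y) = 3 - card (X \<inter> Y)" "card (Y - X) = 3 - card (X \<inter> Y)"
    using card_Diff_subset_Int[of X Y] card_Diff_subset_Int[of Y X] fin card3
    by (simp_all add: Int_commute)
  have split: "X = (X - Y) \<union> (X \<inter> Y)" "Y = (Y - X) \<union> (X \<inter> Y)"
    by blast+
  have "X \<inter> Y \<noteq> X"
    using \<open>X \<noteq> Y\<close> card_seteq[OF fin(2), of X] card3 by auto
  then have "card (X \<inter> Y) < 3"
    using psubset_card_mono[OF fin(1), of "X \<inter> Y"] card3 by auto
  then consider "card (X \<inter> Y) = 0" | "card (X \<inter> Y) = 1" | "card (X \<inter> Y) = 2"
    by linarith
  then show False
  proof cases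
    case 1
    then have "X \<inter> Y = {}"
      using fin by simp
    then show False
      using no_disjoint_swap[of X Y] X Y card3 by blast
  next
    case 2
    then obtain z where z: "X \<inter> Y = {z}"
      by (auto simp: card_1_singleton_iff)
    obtain x1 x2 where x: "X - Y = {x1, x2}" "x1 \<noteq> x2"
      using diff(1) 2 by (auto simp: card_2_iff)
    obtain y1 y2 where y: "Y - X = {y1, y2}" "y1 \<noteq> y2"
      using diff(2) 2 by (auto simp: card_2_iff)
    have eqs: "X = {x1, x2, z}" "Y = {y1, y2, z}"
      using split x(1) y(1) z by auto
    have "distinct [x1, x2, y1, y2, z]"
      using x y z by auto
    moreover have "splits Y x1" "splits Y x2" "splits X y1" "splits X y2"
      using X(1) Y(1) x(1) y(1) by auto
    moreover have "card (N z) = 3"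
      using XY(1) z by (intro card_N) auto
    ultimately show False
      using no_double_swap[of y1 y2 z x1 x2] unfolding eqs by blast
  next
    case 3
    then obtain z w where zw: "X \<inter> Y = {z, w}" "z \<noteq> w"
      by (auto simp: card_2_iff)
    obtain x where x: "X - Y = {x}"
      using diff(1) 3 by (auto simp: card_1_singleton_iff)
    obtain y where y: "Y - X = {y}"
      using diff(2) 3 by (auto simp: card_1_singleton_iff)
    have eqs: "X = {x, z, w}" "Y = {y, z, w}"
      using split x(1) y(1) zw by auto
    have "distinct [x, y, z, w]"
      using x y zw by auto
    moreover have "splits Y x" "splits X y"
      using X(1) Y(1) x y by auto
    ultimately show False
      using no_single_swap[of y z w x] unfolding eqs by blast
  qed
qed

end

theorem theorem5:
  fixes D :: "('a, 'b) pre_digraph"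
  assumes "loopfree_digraph D" and "nomulti_digraph D"
    and "in_regular 2 D"
  shows "admits_identifying_code D 3 \<longleftrightarrow>
    oriented_graph D \<and> \<not> contains_copy D TT3 \<and>
    (\<forall>J\<in>forbidden_digraphs. \<not> contains_copy D J)"
proof -
  interpret two_in_regular_digraph D
    using assms by (simp add: two_in_regular_digraph_def two_in_regular_digraph_axioms_def)
  show ?thesis
  proof
    assume "admits_identifying_code D 3"
    then show "oriented_graph D \<and> \<not> contains_copy D TT3 \<and>
        (\<forall>J\<in>forbidden_digraphs. \<not> contains_copy D J)"
      using not_admits_if_digon not_admits_if_TT3 not_admits_if_forbidden assms(1,2)
      unfolding oriented_graph_def by blast
  next
    assume "oriented_graph D \<and> \<not> contains_copy D TT3 \<and>
        (\<forall>J\<in>forbidden_digraphs. \<not> contains_copy D J)"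
    then interpret forbidden_free_digraph D
      by unfold_locales (auto simp: oriented_graph_def)
    show "admits_identifying_code D 3"
      unfolding admits_iff_separated using closed_nbrs_separate by blast
  qed
qed

end
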